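(* Let $K\ge2$ and $m\ge1$ be integers, $n=Km$ with $n-m\ge2$, $\alpha\in(0,1)$, and let $\mathbf D_n=(Z_1,\dots,Z_n)$, $Z_i=(X_i,Y_i)$, be i.i.d. training data in $\mathcal X\times\mathcal Y$, with $(X_{\rm test},Y_{\rm test})$ an independent test point with the same distribution. Suppose that the training algorithm $T$ and the model $\{\mu_\beta\}_{\beta\in\mathbb R^p}$ satisfy the following three assumptions (all notation is as in the context): (A1) (uniform stability) for every sample size $k\ge 2$ and every $i\in\{1,\dots,k\}$, $$\sup_{z_1,\dots,z_k\in\mathcal X\times\mathcal Y}\big\|\mu_{T(z_1,\dots,z_{i-1},z_{i+1},\dots,z_k)}-\mu_{T(z_1,\dots,z_k)}\big\|_\infty\le \frac{c_k}{2};$$ (A2) (bi-Lipschitz parametrization) there are constants $\kappa_1>0$ and $\kappa_2<\infty$ such that $\kappa_1\|\beta-\beta'\|_\infty\le\|\mu_\beta-\mu_{\beta'}\|_\infty\le\kappa_2\|\beta-\beta'\|_\infty$ for all $\beta,\beta'\in\mathbb R^p$; (A3) (bounded density) for every $k$, the distribution function $F_k$ has a density $F_k'$ satisfying $F_k'<L_k$. Let $P_e^{\mathrm{CV+}}(\mathbf D_n)=\mathbb P\big(Y_{\rm test}\notin\hat C^{\mathrm{CV+}}_\alpha(X_{\rm test})\,\big|\,\mathbf D_n\big)$ be the training-conditional miscoverage rate of the $K$-fold CV+ interval with $m$ samples in each fold. Then for all $\epsilon,\delta>0$, $$\mathbb P\left(P_e^{\mathrm{CV+}}(\mathbf D_n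)>\alpha+\sqrt{\frac{\log(2/\delta)}{2n}}+2\,m\,L_{n-m}\,\kappa_2\,c_{n-m}\left(\frac1{\kappa_1}+\sqrt{\frac{n}{2\kappa_1^2}\log\frac{2p}{\epsilon}}\right)\right)\le\epsilon+\delta.$$
   Context: $\mathcal X$ is a measurable space and $\mathcal Y\subseteq\mathbb R$ is Borel. For each $\beta\in\mathbb R^p$ ($p\ge1$), $\mu_\beta:\mathcal X\to\mathbb R$ is a bounded measurable predictor function; $\|\mu\|_\infty=\sup_{x\in\mathcal X}|\mu(x)|$ for functions, and $\|\cdot\|_\infty$ is the max-norm on $\mathbb R^p$. A training algorithm is a measurable map $T:\bigcup_{k\ge1}(\mathcal X\times\mathcal Y)^k\to\mathbb R^p$; the fitted predictor on data $(z_1,\dots,z_k)$ is $\mu_{T(z_1,\dots,z_k)}$. The constants $c_k>0$ and $L_k$ are finite and may depend on the sample size $k$. Write $\overline\beta_k=\mathbb E\,T(Z_1,\dots,Z_k)$ (coordinatewise expectation, $Z_i$ i.i.d. from the data distribution), and $$F_k(t)=\mathbb P\big(|Y-\mu_{\overline\beta_k}(X)|\le t\big),$$ where $(X,Y)$ has the data distribution. $K$-fold CV+: the index set $\{1,\dots,n\}$ is partitioned (deterministically) into $K$ folds $S_1,\dots,S_K$ of size $m$ each; $k(i)$ denotes the index of the fold containing $i$. Let $\hat\beta_{-S_k}$ be $T$ applied to the tuple $(Z_j)_{j\notin S_k}$ (in increasing order of index) and $R_i=|Y_i-\mu_{\hat\beta_{-S_{k(i)}}}(X_i)|$. For a finite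 multiset $A$ of $n$ real numbers, let $\hat q^+_\alpha(A)$ be the $\lceil(1-\alpha)(n+1)\rceil$-th smallest element of $A$ and $\hat q^-_\alpha(A)$ the $\lfloor\alpha(n+1)\rfloor$-th smallest element of $A$, with the conventions $\hat q^+_\alpha(A)=+\infty$ and $\hat q^-_\alpha(A)=-\infty$ if $\alpha<1/(n+1)$. The CV+ prediction interval is $$\hat C^{\mathrm{CV+}}_\alpha(x)=\Big[\hat q^-_\alpha\big(\{\mu_{\hat\beta_{-S_{k(i)}}}(x)-R_i\}_{i=1}^n\big),\ \hat q^+_\alpha\big(\{\mu_{\hat\beta_{-S_{k(i)}}}(x)+R_i\}_{i=1}^n\big)\Big].$$ A square root in the bound can have a negative argument only when $\epsilon+\delta\ge1$, in which case the inequality is regarded as trivially true. *)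

theory Defs
  imports "HOL-Probability.Probability"
begin

text \<open>
  The feature space is a measure \<open>MX\<close>, of which only \<open>space MX\<close> and \<open>sets MX\<close> matter, and the
  label set is \<open>Y\<close>. Tuples of data points are lists, and sample indices start at \<open>0\<close>.
\<close>

definition data_space :: "'x measure \<Rightarrow> real set \<Rightarrow> ('x \<times> real) measure" where
  "data_space MX Y = MX \<Otimes>\<^sub>M restrict_space borel Y"

text \<open>Only meaningful for functions that are bounded on the (nonempty) space of \<open>MX\<close>.\<close>

definition sup_norm :: "'x measure \<Rightarrow> ('x \<Rightarrow> real) \<Rightarrow> real" where
  "sup_norm MX f = (SUP x\<in>space MX. \<bar>f x\<bar>)"

definition predictor_model :: "'x measure \<Rightarrow> (real ^ 'p \<Rightarrow> 'x \<Rightarrow> real) \<Rightarrow> bool" where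
  "predictor_model MX \<mu> \<longleftrightarrow>
     (\<forall>\<beta>. \<mu> \<beta> \<in> borel_measurable MX \<and> bounded (\<mu> \<beta> ` space MX))"

text \<open>
  The domain is the disjoint union of the product spaces over all sample sizes \<open>k \<ge> 1\<close>, so
  measurability is measurability on each of them.
\<close>

definition training_algorithm ::
    "'x measure \<Rightarrow> real set \<Rightarrow> (('x \<times> real) list \<Rightarrow> real ^ 'p) \<Rightarrow> bool" where
  "training_algorithm MX Y T \<longleftrightarrow>
     (\<forall>k\<ge>1. (\<lambda>z. T (map z [0..<k])) \<in>
        borel_measurable (Pi\<^sub>M {..<k} (\<lambda>_. data_space MX Y)))"

definition uniformly_stable ::
    "'x measure \<Rightarrow> real set \<Rightarrow> (real ^ 'p \<Rightarrow> 'x \<Rightarrow> real) \<Rightarrow>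
     (('x \<times> real) list \<Rightarrow> real ^ 'p) \<Rightarrow> (nat \<Rightarrow> real) \<Rightarrow> bool" where
  "uniformly_stable MX Y \<mu> T c \<longleftrightarrow>
     (\<forall>k\<ge>2. \<forall>i<k. \<forall>zs. length zs = k \<longrightarrow> set zs \<subseteq> space MX \<times> Y \<longrightarrow>
        sup_norm MX (\<lambda>x. \<mu> (T (take i zs @ drop (Suc i) zs)) x - \<mu> (T zs) x) \<le> c k / 2)"

text \<open>\<^const>\<open>infnorm\<close> is the max-norm on \<open>real ^ 'p\<close>.\<close>

definition bi_lipschitz ::
    "'x measure \<Rightarrow> (real ^ 'p \<Rightarrow> 'x \<Rightarrow> real) \<Rightarrow> real \<Rightarrow> real \<Rightarrow> bool" where
  "bi_lipschitz MX \<mu> \<kappa>\<^sub>1 \<kappa>\<^sub>2 \<longleftrightarrow>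
     (\<forall>\<beta> \<beta>'. \<kappa>\<^sub>1 * infnorm (\<beta> - \<beta>') \<le> sup_norm MX (\<lambda>x. \<mu> \<beta> x - \<mu> \<beta>' x) \<and>
             sup_norm MX (\<lambda>x. \<mu> \<beta> x - \<mu> \<beta>' x) \<le> \<kappa>\<^sub>2 * infnorm (\<beta> - \<beta>'))"

text \<open>\<open>P\<close> is the distribution of a single data point.\<close>

definition mean_param ::
    "('x \<times> real) measure \<Rightarrow> (('x \<times> real) list \<Rightarrow> real ^ 'p) \<Rightarrow> nat \<Rightarrow> real ^ 'p" where
  "mean_param P T k = (\<chi> j. \<integral>z. T (map z [0..<k]) $ j \<partial>(Pi\<^sub>M {..<k} (\<lambda>_. P)))"

definition resid_cdf ::
    "('x \<times> real) measure \<Rightarrow> (real ^ 'p \<Rightarrow> 'x \<Rightarrow> real) \<Rightarrow>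
     (('x \<times> real) list \<Rightarrow> real ^ 'p) \<Rightarrow> nat \<Rightarrow> real \<Rightarrow> real" where
  "resid_cdf P \<mu> T k t =
     measure P {z \<in> space P. \<bar>snd z - \<mu> (mean_param P T k) (fst z)\<bar> \<le> t}"

text \<open>A density in the sense of Lebesgue integration; \<open>F\<close> need not be differentiable everywhere.\<close>

definition has_density :: "(real \<Rightarrow> real) \<Rightarrow> (real \<Rightarrow> real) \<Rightarrow> bool" where
  "has_density F f \<longleftrightarrow> f \<in> borel_measurable borel \<and> (\<forall>t. 0 \<le> f t) \<and>
     (\<forall>t. set_integrable lborel {..t} f \<and> F t = (LINT s:{..t}|lborel. f s))"

definition bounded_density ::
    "('x \<times> real) measure \<Rightarrow> (real ^ 'p \<Rightarrow> 'x \<Rightarrow> real) \<Rightarrow>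
     (('x \<times> real) list \<Rightarrow> real ^ 'p) \<Rightarrow> (nat \<Rightarrow> real) \<Rightarrow> bool" where
  "bounded_density P \<mu> T L \<longleftrightarrow>
     (\<forall>k\<ge>1. \<exists>f. has_density (resid_cdf P \<mu> T k) f \<and> (\<forall>t. f t < L k))"

definition kth_smallest :: "real multiset \<Rightarrow> nat \<Rightarrow> real" where
  "kth_smallest A k = sorted_list_of_multiset A ! (k - 1)"

text \<open>
  If \<open>0 < \<alpha> < 1\<close>, the ranks below lie between \<open>1\<close> and \<open>size A\<close> in the second case.
\<close>

definition quant_up :: "real \<Rightarrow> real multiset \<Rightarrow> ereal" where
  "quant_up \<alpha> A = (if \<alpha> < 1 / real (size A + 1) then \<infinity>
     else ereal (kth_smallest A (nat \<lceil>(1 - \<alpha>) * real (size A + 1)\<rceil>)))"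

definition quant_lo :: "real \<Rightarrow> real multiset \<Rightarrow> ereal" where
  "quant_lo \<alpha> A = (if \<alpha> < 1 / real (size A + 1) then - \<infinity>
     else ereal (kth_smallest A (nat \<lfloor>\<alpha> * real (size A + 1)\<rfloor>)))"

definition folds :: "nat \<Rightarrow> nat \<Rightarrow> nat \<Rightarrow> (nat \<Rightarrow> nat set) \<Rightarrow> bool" where
  "folds n K m S \<longleftrightarrow> (\<Union>k<K. S k) = {..<n} \<and> disjoint_family_on S {..<K} \<and>
     (\<forall>k<K. card (S k) = m)"

definition fold_index :: "nat \<Rightarrow> (nat \<Rightarrow> nat set) \<Rightarrow> nat \<Rightarrow> nat" where
  "fold_index K S i = (THE k. k < K \<and> i \<in> S k)"

text \<open>In the following, the training data are \<open>z 0, \<dots>, z (n - 1)\<close>.\<close>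

definition fit_without ::
    "(('x \<times> real) list \<Rightarrow> real ^ 'p) \<Rightarrow> nat \<Rightarrow> nat set \<Rightarrow> (nat \<Rightarrow> 'x \<times> real) \<Rightarrow> real ^ 'p" where
  "fit_without T n B z = T (map z (filter (\<lambda>j. j \<notin> B) [0..<n]))"

definition cv_residual ::
    "(real ^ 'p \<Rightarrow> 'x \<Rightarrow> real) \<Rightarrow> (('x \<times> real) list \<Rightarrow> real ^ 'p) \<Rightarrow> nat \<Rightarrow> nat \<Rightarrow>
     (nat \<Rightarrow> nat set) \<Rightarrow> (nat \<Rightarrow> 'x \<times> real) \<Rightarrow> nat \<Rightarrow> real" where
  "cv_residual \<mu> T n K S z i =
     \<bar>snd (z i) - \<mu> (fit_without T n (S (fold_index K S i)) z) (fst (z i))\<bar>"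

definition cv_plus_interval ::
    "(real ^ 'p \<Rightarrow> 'x \<Rightarrow> real) \<Rightarrow> (('x \<times> real) list \<Rightarrow> real ^ 'p) \<Rightarrow> nat \<Rightarrow> nat \<Rightarrow>
     (nat \<Rightarrow> nat set) \<Rightarrow> real \<Rightarrow> (nat \<Rightarrow> 'x \<times> real) \<Rightarrow> 'x \<Rightarrow> real set" where
  "cv_plus_interval \<mu> T n K S \<alpha> z x =
     {y. quant_lo \<alpha> {# \<mu> (fit_without T n (S (fold_index K S i)) z) x
                        - cv_residual \<mu> T n K S z i. i \<in># mset_set {..<n} #} \<le> ereal y \<and>
         ereal y \<le> quant_up \<alpha> {# \<mu> (fit_without T n (S (fold_index K S i)) z) x
                        + cv_residual \<mu> T n K S z i. i \<in># mset_set {..<n} #}}"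

text \<open>
  \<open>Z 0, \<dots>, Z (n - 1)\<close> are the training data and \<open>Z n\<close> is the test point; the conditioning is on
  the sigma-algebra generated by the training data.
\<close>

definition train_sigma ::
    "'w measure \<Rightarrow> ('x \<times> real) measure \<Rightarrow> nat \<Rightarrow> (nat \<Rightarrow> 'w \<Rightarrow> 'x \<times> real) \<Rightarrow> 'w measure" where
  "train_sigma M N n Z =
     vimage_algebra (space M) (\<lambda>\<omega>. \<lambda>i\<in>{..<n}. Z i \<omega>) (Pi\<^sub>M {..<n} (\<lambda>_. N))"

definition cv_plus_miscoverage ::
    "'w measure \<Rightarrow> ('x \<times> real) measure \<Rightarrow> (real ^ 'p \<Rightarrow> 'x \<Rightarrow> real) \<Rightarrow>
     (('x \<times> real) list \<Rightarrow> real ^ 'p) \<Rightarrow> nat \<Rightarrow> nat \<Rightarrow> (nat \<Rightarrow> nat set) \<Rightarrow> real \<Rightarrow>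
     (nat \<Rightarrow> 'w \<Rightarrow> 'x \<times> real) \<Rightarrow> 'w \<Rightarrow> real" where
  "cv_plus_miscoverage M N \<mu> T n K S \<alpha> Z =
     real_cond_exp M (train_sigma M N n Z)
       (indicator {\<omega> \<in> space M.
          snd (Z n \<omega>) \<notin> cv_plus_interval \<mu> T n K S \<alpha> (\<lambda>i. Z i \<omega>) (fst (Z n \<omega>))})"

end

theory Submission
  imports Defs
begin

text \<open>
  Let \<open>N = n - m\<close> and \<open>b = mean_param P T N\<close>. By stability and the bi-Lipschitz condition, the
  coordinates of \<open>T\<close> on \<open>N\<close> points have bounded differences \<open>c N / \<kappa>\<^sub>1\<close>, so McDiarmid's inequality
  puts the fit without the first fold close to \<open>b\<close>; every other fit arises from this one by \<open>m\<close>
  exchanges of data points. Hence, outside an event of probability \<open>\<epsilon>\<close>, all fitted predictors are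
  uniformly \<open>\<eta>\<close>-close to \<open>\<mu> b\<close>, where \<open>2 * L N * \<eta>\<close> is the last term of the claimed bound,
  and a miscovered test point has a residual with respect to \<open>\<mu> b\<close> exceeding, up to \<open>2 * \<eta>\<close>, a fraction \<open>1 - \<alpha>\<close> of the training residuals. The Dvoretzky-Kiefer-Wolfowitz
  inequality is not needed for this: with \<open>s = sqrt (ln (2 / \<delta>) / (2 * n))\<close> and \<open>r\<close> the
  \<open>(1 - \<alpha> - s)\<close>-quantile of the residual with respect to \<open>\<mu> b\<close>, Hoeffding's inequality at the single
  threshold \<open>r\<close> shows that fewer than \<open>(1 - \<alpha>) * n\<close> training residuals are at most \<open>r\<close>, outside an
  event of probability \<open>\<delta> / 2\<close>. The test residual then exceeds \<open>r - 2 * \<eta>\<close>, which has probability at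
  most \<open>\<alpha> + s + 2 * L N * \<eta>\<close> by the density bound.
\<close>

subsection \<open>McDiarmid's inequality\<close>

text \<open>The bound is demanded at every point, not almost everywhere, so that it passes to every
  section \<open>x(i := y)\<close> and to the integral over one coordinate.\<close>

definition bounded_differences ::
    "'i set \<Rightarrow> ('i \<Rightarrow> 'a measure) \<Rightarrow> ('i \<Rightarrow> real) \<Rightarrow> (('i \<Rightarrow> 'a) \<Rightarrow> real) \<Rightarrow> bool" where
  "bounded_differences I M c f \<longleftrightarrow>
     (\<forall>x\<in>space (Pi\<^sub>M I M). \<forall>i\<in>I. \<forall>y\<in>space (M i). \<bar>f (x(i := y)) - f x\<bar> \<le> c i)"

lemma bounded_differencesD:
  "bounded_differences I M c f \<Longrightarrow> x \<in> space (Pi\<^sub>M I M) \<Longrightarrow> i \<in> I \<Longrightarrow> y \<in> space (M i) \<Longrightarrow>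
    \<bar>f (x(i := y)) - f x\<bar> \<le> c i"
  by (simp add: bounded_differences_def)

lemma bounded_differences_uminus:
  "bounded_differences I M c f \<Longrightarrow> bounded_differences I M c (\<lambda>x. - f x)"
  by (simp add: bounded_differences_def) (metis abs_minus_commute)

lemma fun_upd_in_space_PiM:
  assumes "x \<in> space (Pi\<^sub>M I M)" "y \<in> space (M i)"
  shows "x(i := y) \<in> space (Pi\<^sub>M (insert i I) M)"
  using assms by (auto simp: space_PiM PiE_iff extensional_def)

text \<open>The coordinates of \<open>x\<close> are replaced by those of \<open>y\<close> one at a
  time; \<open>w J\<close> is the hybrid point after the replacements in \<open>J\<close>. This
  bounds \<open>f\<close> and thereby gives its integrability.\<close>

lemma bounded_differences_diff_le:
  assumes "finite I" "bounded_differences I M c f"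
    and x: "x \<in> space (Pi\<^sub>M I M)" and y: "y \<in> space (Pi\<^sub>M I M)"
  shows "\<bar>f y - f x\<bar> \<le> sum c I"
proof -
  define w where "w J = (\<lambda>i. if i \<in> J then y i else x i)" for J
  have w_space: "w J \<in> space (Pi\<^sub>M I M)" for J
    using x y by (auto simp: w_def space_PiM PiE_iff extensional_def)
  have "J \<subseteq> I \<Longrightarrow> \<bar>f (w J) - f x\<bar> \<le> sum c J" if "finite J" for J
    using that
  proof (induction J)
    case empty
    then show ?case by (simp add: w_def)
  next
    case (insert i J)
    have "w (insert i J) = (w J)(i := y i)"
      by (auto simp: w_def)
    moreover have "y i \<in> space (M i)"
      using y insert.prems by (auto simp: space_PiM PiE_iff)
    ultimately have "\<bar>f (w (insert i J)) - f (w J)\<bar> \<le> c i"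
      using bounded_differencesD[OF assms(2) w_space, of i "y i"] insert.prems by simp
    then show ?case
      using insert by simp
  qed
  from this[OF \<open>finite I\<close>] have "\<bar>f (w I) - f x\<bar> \<le> sum c I" by simp
  moreover have "w I = y"
    using x y by (force simp: w_def space_PiM PiE_iff extensional_def)
  ultimately show ?thesis by simp
qed

lemma integrable_bounded_differences:
  assumes "finite I" "\<And>i. prob_space (M i)"
    and "f \<in> borel_measurable (Pi\<^sub>M I M)" "bounded_differences I M c f"
  shows "integrable (Pi\<^sub>M I M) f"
proof -
  interpret P: prob_space "Pi\<^sub>M I M"
    by (rule prob_space_PiM) (rule assms)
  obtain x where x: "x \<in> space (Pi\<^sub>M I M)"
    using P.not_empty by blast
  have "AE y in Pi\<^sub>M I M. norm (f y) \<le> \<bar>f x\<bar> + sum c I"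
  proof (rule AE_I2)
    fix y assume "y \<in> space (Pi\<^sub>M I M)"
    from bounded_differences_diff_le[OF assms(1,4) x this] show "norm (f y) \<le> \<bar>f x\<bar> + sum c I"
      by simp
  qed
  then show ?thesis
    using assms(3) by (rule P.integrable_const_bound)
qed

text \<open>With \<open>a\<close> the infimum of \<open>f\<close>, the range lies in an interval of
  length \<open>c\<close> starting at \<open>a\<close>, and Hoeffding's lemma applies. Only the
  length is prescribed: for a section of a function of several variables, the position of the
  interval moves with the other coordinates.\<close>

lemma (in prob_space) Hoeffdings_lemma_oscillation:
  fixes f :: "'a \<Rightarrow> real"
  assumes f [measurable]: "f \<in> borel_measurable M"
    and osc: "\<And>x y. x \<in> space M \<Longrightarrow> y \<in> space M \<Longrightarrow> f x - f y \<le> c"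
    and "l > 0"
  shows "(\<integral>\<^sup>+x. exp (l * (f x - expectation f)) \<partial>M) \<le> ennreal (exp (l\<^sup>2 * c\<^sup>2 / 8))"
proof -
  define a where "a = (INF x\<in>space M. f x)"
  obtain x0 where x0: "x0 \<in> space M"
    using not_empty by auto
  have "f x0 - c \<le> f x" if "x \<in> space M" for x
    using osc[OF x0 that] by linarith
  then have bdd: "bdd_below (f ` space M)"
    by (intro bdd_belowI2)
  have "a \<le> f x" if "x \<in> space M" for x
    unfolding a_def using bdd that by (rule cINF_lower)
  moreover have "f x \<le> a + c" if "x \<in> space M" for x
  proof -
    have "f x - c \<le> f y" if "y \<in> space M" for y
      using osc[OF \<open>x \<in> space M\<close> that] by linarith
    then have "f x - c \<le> a"
      unfolding a_def using x0 by (intro cINF_greatest) auto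
    then show ?thesis by simp
  qed
  ultimately interpret interval_bounded_random_variable M f a "a + c"
    by unfold_locales auto
  show ?thesis
    using Hoeffdings_lemma_nn_integral[OF \<open>l > 0\<close>] by simp
qed

text \<open>The martingale argument as an induction over the coordinates. Let \<open>g\<close> be
  \<open>f\<close> with coordinate \<open>i\<close> integrated out, and split
  \<open>f - E = (f - g) + (g - E)\<close>. Given the other coordinates, Hoeffding's lemma controls
  the first summand; \<open>g\<close> inherits the bounded differences, so the induction hypothesis
  controls the second.\<close>

lemma bounded_differences_mgf_le:
  assumes "finite I" and prob: "\<And>i. prob_space (M i)"
    and "f \<in> borel_measurable (Pi\<^sub>M I M)" "bounded_differences I M c f" and l: "l > 0"
  shows "(\<integral>\<^sup>+x. exp (l * (f x - (\<integral>y. f y \<partial>Pi\<^sub>M I M))) \<partial>Pi\<^sub>M I M) \<le>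
    ennreal (exp (l\<^sup>2 * (\<Sum>i\<in>I. (c i)\<^sup>2) / 8))"
  using assms(1,3,4)
proof (induction I arbitrary: f)
  case empty
  then show ?case
    by (simp add: PiM_empty nn_integral_count_space_finite lebesgue_integral_count_space_finite)
next
  case (insert i I)
  interpret product_prob_space M I
    by (intro product_prob_space.intro product_sigma_finite.intro product_prob_space_axioms.intro
        prob_space_imp_sigma_finite prob)
  have f [measurable]: "f \<in> borel_measurable (Pi\<^sub>M (insert i I) M)" by fact
  have int_f: "integrable (Pi\<^sub>M (insert i I) M) f"
    using insert by (intro integrable_bounded_differences prob) auto
  define g where "g x = (\<integral>y. f (x(i := y)) \<partial>M i)" for x
  have g [measurable]: "g \<in> borel_measurable (Pi\<^sub>M I M)"
    unfolding g_def by measurable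
  \<comment> \<open>Fubini would give this for almost every \<open>x\<close> only, whereas the
    differences of \<open>g\<close> have to be bounded at every point.\<close>
  have int_section: "integrable (M i) (\<lambda>y. f (x(i := y)))" if x: "x \<in> space (Pi\<^sub>M I M)" for x
  proof -
    obtain y0 where y0: "y0 \<in> space (M i)"
      using M.not_empty by blast
    have "norm (f (x(i := y))) \<le> \<bar>f (x(i := y0))\<bar> + c i" if "y \<in> space (M i)" for y
      using bounded_differencesD[OF insert.prems(2) fun_upd_in_space_PiM[OF x y0], of i y] that
      unfolding fun_upd_upd real_norm_def by (smt (verit) insertI1)
    then have "AE y in M i. norm (f (x(i := y))) \<le> \<bar>f (x(i := y0))\<bar> + c i"
      by (intro AE_I2) simp
    then show ?thesis
      by (rule M.integrable_const_bound) (use x in measurable)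
  qed
  have "bounded_differences I M c g"
    unfolding bounded_differences_def
  proof (intro ballI)
    fix x j y assume x: "x \<in> space (Pi\<^sub>M I M)" and j: "j \<in> I" and y: "y \<in> space (M j)"
    have xy: "x(j := y) \<in> space (Pi\<^sub>M I M)"
      using fun_upd_in_space_PiM[OF x y] j by (simp add: insert_absorb)
    have diff: "\<bar>f ((x(j := y))(i := v)) - f (x(i := v))\<bar> \<le> c j" if "v \<in> space (M i)" for v
    proof -
      have "(x(j := y))(i := v) = (x(i := v))(j := y)"
        using j insert.hyps by (auto simp: fun_upd_twist)
      then show ?thesis
        using bounded_differencesD[OF insert.prems(2) fun_upd_in_space_PiM[OF x that], of j y] j y
        by (simp del: fun_upd_apply)
    qed
    have "\<bar>g (x(j := y)) - g x\<bar> = \<bar>\<integral>v. f ((x(j := y))(i := v)) - f (x(i := v)) \<partial>M i\<bar>"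
      unfolding g_def using int_section[OF x] int_section[OF xy] by simp
    also have "\<dots> \<le> (\<integral>v. \<bar>f ((x(j := y))(i := v)) - f (x(i := v))\<bar> \<partial>M i)"
      by (rule integral_abs_bound)
    also have "\<dots> \<le> c j"
      using int_section[OF x] int_section[OF xy] diff
      by (intro M.integral_le_const AE_I2) auto
    finally show "\<bar>g (x(j := y)) - g x\<bar> \<le> c j" .
  qed
  then have IH: "(\<integral>\<^sup>+x. exp (l * (g x - (\<integral>y. g y \<partial>Pi\<^sub>M I M))) \<partial>Pi\<^sub>M I M) \<le>
      ennreal (exp (l\<^sup>2 * (\<Sum>i\<in>I. (c i)\<^sup>2) / 8))"
    by (intro insert.IH g)
  define E where "E = (\<integral>y. g y \<partial>Pi\<^sub>M I M)"
  have E: "(\<integral>x. f x \<partial>Pi\<^sub>M (insert i I) M) = E"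
    unfolding E_def g_def using insert.hyps int_f by (rule product_integral_insert)
  have fibre: "(\<integral>\<^sup>+y. exp (l * (f (x(i := y)) - g x)) \<partial>M i) \<le> ennreal (exp (l\<^sup>2 * (c i)\<^sup>2 / 8))"
    if x: "x \<in> space (Pi\<^sub>M I M)" for x
    unfolding g_def
  proof (rule M.Hoeffdings_lemma_oscillation[OF _ _ l])
    show "(\<lambda>y. f (x(i := y))) \<in> borel_measurable (M i)"
      using x by measurable
    fix y y' assume "y \<in> space (M i)" "y' \<in> space (M i)"
    then show "f (x(i := y)) - f (x(i := y')) \<le> c i"
      using bounded_differencesD[OF insert.prems(2) fun_upd_in_space_PiM[OF x], of y' i y]
      unfolding fun_upd_upd by (smt (verit) insertI1)
  qed
  have "(\<integral>\<^sup>+x. exp (l * (f x - E)) \<partial>Pi\<^sub>M (insert i I) M) =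
      (\<integral>\<^sup>+x. (\<integral>\<^sup>+y. exp (l * (f (x(i := y)) - E)) \<partial>M i) \<partial>Pi\<^sub>M I M)"
    using insert.hyps by (intro product_nn_integral_insert) auto
  \<comment> \<open>The factor with \<open>g x - E\<close> is constant on the fibre and leaves the
    inner integral.\<close>
  also have "\<dots> = (\<integral>\<^sup>+x. ennreal (exp (l * (g x - E))) *
      (\<integral>\<^sup>+y. exp (l * (f (x(i := y)) - g x)) \<partial>M i) \<partial>Pi\<^sub>M I M)"
  proof (rule nn_integral_cong)
    fix x assume [measurable]: "x \<in> space (Pi\<^sub>M I M)"
    have "exp (l * (f (x(i := y)) - E)) = exp (l * (g x - E)) * exp (l * (f (x(i := y)) - g x))" for y
      by (simp add: algebra_simps flip: exp_add)
    then show "(\<integral>\<^sup>+y. exp (l * (f (x(i := y)) - E)) \<partial>M i) =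
        ennreal (exp (l * (g x - E))) * (\<integral>\<^sup>+y. exp (l * (f (x(i := y)) - g x)) \<partial>M i)"
      by (simp add: ennreal_mult' nn_integral_cmult)
  qed
  also have "\<dots> \<le> (\<integral>\<^sup>+x. ennreal (exp (l * (g x - E))) * ennreal (exp (l\<^sup>2 * (c i)\<^sup>2 / 8)) \<partial>Pi\<^sub>M I M)"
    by (intro nn_integral_mono mult_left_mono fibre) auto
  also have "\<dots> = (\<integral>\<^sup>+x. exp (l * (g x - E)) \<partial>Pi\<^sub>M I M) * ennreal (exp (l\<^sup>2 * (c i)\<^sup>2 / 8))"
    by (rule nn_integral_multc) measurable
  also have "\<dots> \<le> ennreal (exp (l\<^sup>2 * (\<Sum>i\<in>I. (c i)\<^sup>2) / 8)) * ennreal (exp (l\<^sup>2 * (c i)\<^sup>2 / 8))"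
    using IH unfolding E_def by (rule mult_right_mono) simp
  also have "\<dots> = ennreal (exp (l\<^sup>2 * (\<Sum>i\<in>insert i I. (c i)\<^sup>2) / 8))"
    using insert.hyps
    by (simp add: algebra_simps add_divide_distrib flip: ennreal_mult' exp_add)
  finally show ?case
    unfolding E .
qed

text \<open>Chernoff's bound combined with the estimate of the moment generating function.\<close>

theorem McDiarmid_ineq_ge:
  assumes "finite I" and prob: "\<And>i. prob_space (M i)"
    and f [measurable]: "f \<in> borel_measurable (Pi\<^sub>M I M)" and "bounded_differences I M c f"
    and t: "t > 0" and d: "(\<Sum>i\<in>I. (c i)\<^sup>2) > 0"
  shows "measure (Pi\<^sub>M I M) {x \<in> space (Pi\<^sub>M I M). f x - (\<integral>y. f y \<partial>Pi\<^sub>M I M) \<ge> t} \<le>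
    exp (- 2 * t\<^sup>2 / (\<Sum>i\<in>I. (c i)\<^sup>2))"
proof -
  interpret P: prob_space "Pi\<^sub>M I M"
    by (rule prob_space_PiM) (rule prob)
  define d where "d = (\<Sum>i\<in>I. (c i)\<^sup>2)"
  \<comment> \<open>The minimiser of the exponent \<open>- l * t + l\<^sup>2 * d / 8\<close>, whose
    minimum is \<open>- 2 * t\<^sup>2 / d\<close>.\<close>
  define l where "l = 4 * t / d"
  define E where "E = (\<integral>y. f y \<partial>Pi\<^sub>M I M)"
  have d: "d > 0" and l: "l > 0"
    using assms by (simp_all add: d_def l_def)
  have "ennreal (measure (Pi\<^sub>M I M) {x \<in> space (Pi\<^sub>M I M). f x - E \<ge> t}) =
      emeasure (Pi\<^sub>M I M) {x \<in> space (Pi\<^sub>M I M). f x - E \<ge> t}"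
    by (simp add: P.emeasure_eq_measure)
  also have "\<dots> \<le> ennreal (exp (- l * t)) *
      (\<integral>\<^sup>+x\<in>space (Pi\<^sub>M I M). exp (l * (f x - E)) \<partial>Pi\<^sub>M I M)"
    by (intro Chernoff_ineq_nn_integral_ge l) auto
  also have "(\<integral>\<^sup>+x\<in>space (Pi\<^sub>M I M). exp (l * (f x - E)) \<partial>Pi\<^sub>M I M) =
      (\<integral>\<^sup>+x. exp (l * (f x - E)) \<partial>Pi\<^sub>M I M)"
    by (intro nn_integral_cong) simp
  also have "ennreal (exp (- l * t)) * \<dots> \<le> ennreal (exp (- l * t)) * ennreal (exp (l\<^sup>2 * d / 8))"
    unfolding E_def d_def using assms l by (intro mult_left_mono bounded_differences_mgf_le) auto
  also have "\<dots> = ennreal (exp (- 2 * t\<^sup>2 / d))"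
    using d by (simp add: l_def field_simps power2_eq_square flip: ennreal_mult' exp_add)
  finally show ?thesis
    by (simp add: E_def d_def)
qed

corollary McDiarmid_ineq_abs_ge:
  assumes "finite I" and "\<And>i. prob_space (M i)"
    and [measurable]: "f \<in> borel_measurable (Pi\<^sub>M I M)" and "bounded_differences I M c f"
    and "t > 0" and "(\<Sum>i\<in>I. (c i)\<^sup>2) > 0"
  shows "measure (Pi\<^sub>M I M) {x \<in> space (Pi\<^sub>M I M). \<bar>f x - (\<integral>y. f y \<partial>Pi\<^sub>M I M)\<bar> \<ge> t} \<le>
    2 * exp (- 2 * t\<^sup>2 / (\<Sum>i\<in>I. (c i)\<^sup>2))"
proof -
  interpret P: prob_space "Pi\<^sub>M I M"
    by (rule prob_space_PiM) (rule assms)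
  define E where "E = (\<integral>y. f y \<partial>Pi\<^sub>M I M)"
  let ?S = "space (Pi\<^sub>M I M)"
  have "{x \<in> ?S. \<bar>f x - E\<bar> \<ge> t} = {x \<in> ?S. f x - E \<ge> t} \<union> {x \<in> ?S. - f x - (- E) \<ge> t}"
    by auto
  also have "P.prob \<dots> \<le> P.prob {x \<in> ?S. f x - E \<ge> t} + P.prob {x \<in> ?S. - f x - (- E) \<ge> t}"
    by (intro measure_Un_le) auto
  also have "\<dots> \<le> exp (- 2 * t\<^sup>2 / (\<Sum>i\<in>I. (c i)\<^sup>2)) + exp (- 2 * t\<^sup>2 / (\<Sum>i\<in>I. (c i)\<^sup>2))"
  proof (rule add_mono)
    show "P.prob {x \<in> ?S. f x - E \<ge> t} \<le> exp (- 2 * t\<^sup>2 / (\<Sum>i\<in>I. (c i)\<^sup>2))"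
      unfolding E_def using assms by (intro McDiarmid_ineq_ge) auto
    have "bounded_differences I M c (\<lambda>x. - f x)"
      by (intro bounded_differences_uminus assms)
    then show "P.prob {x \<in> ?S. - f x - (- E) \<ge> t} \<le> exp (- 2 * t\<^sup>2 / (\<Sum>i\<in>I. (c i)\<^sup>2))"
      using McDiarmid_ineq_ge[OF assms(1,2) _ _ assms(5,6), of "\<lambda>x. - f x"] by (simp add: E_def)
  qed
  finally show ?thesis
    by (simp add: E_def)
qed

subsection \<open>Stability under exchange of data points\<close>

lemma abs_le_sup_norm:
  assumes "bounded (f ` space MX)" "x \<in> space MX"
  shows "\<bar>f x\<bar> \<le> sup_norm MX f"
  unfolding sup_norm_def
proof (rule cSUP_upper[OF assms(2)])
  obtain B where "\<And>x. x \<in> space MX \<Longrightarrow> \<bar>f x\<bar> \<le> B"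
    using assms(1) by (auto simp: bounded_iff)
  then show "bdd_above ((\<lambda>x. \<bar>f x\<bar>) ` space MX)"
    by (intro bdd_aboveI2)
qed

lemma sup_norm_diff_commute: "sup_norm MX (\<lambda>x. f x - g x) = sup_norm MX (\<lambda>x. g x - f x)"
  unfolding sup_norm_def by (simp add: abs_minus_commute)

lemma sup_norm_diff_triangle:
  assumes "space MX \<noteq> {}" "bounded (f ` space MX)" "bounded (g ` space MX)" "bounded (h ` space MX)"
  shows "sup_norm MX (\<lambda>x. f x - h x) \<le>
    sup_norm MX (\<lambda>x. f x - g x) + sup_norm MX (\<lambda>x. g x - h x)"
proof -
  have "\<bar>f x - h x\<bar> \<le> sup_norm MX (\<lambda>x. f x - g x) + sup_norm MX (\<lambda>x. g x - h x)"
    if x: "x \<in> space MX" for x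
    using abs_le_sup_norm[OF bounded_minus_comp[OF assms(2,3)] x]
      abs_le_sup_norm[OF bounded_minus_comp[OF assms(3,4)] x] by linarith
  then show ?thesis
    unfolding sup_norm_def[of _ "\<lambda>x. f x - h x"] by (intro cSUP_least assms)
qed

text \<open>Deleting \<open>a\<close> from the first list and \<open>b\<close> from the second
  leaves the same list, and each deletion costs \<open>c k / 2\<close>. The positions of
  \<open>a\<close> and \<open>b\<close> may differ.\<close>

lemma uniformly_stable_exchange:
  assumes "predictor_model MX \<mu>" "space MX \<noteq> {}" "uniformly_stable MX Y \<mu> T c"
    and k: "length (xs @ a # ys) = k" "length (us @ b # vs) = k" "k \<ge> 2"
    and "set (xs @ a # ys) \<subseteq> space MX \<times> Y" "set (us @ b # vs) \<subseteq> space MX \<times> Y"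
    and eq: "xs @ ys = us @ vs"
  shows "sup_norm MX (\<lambda>x. \<mu> (T (xs @ a # ys)) x - \<mu> (T (us @ b # vs)) x) \<le> c k"
proof -
  have delete: "sup_norm MX (\<lambda>x. \<mu> (T (xs @ ys)) x - \<mu> (T (xs @ a # ys)) x) \<le> c k / 2"
    if "length (xs @ a # ys) = k" "set (xs @ a # ys) \<subseteq> space MX \<times> Y" for a and xs ys
    using assms(3) that \<open>k \<ge> 2\<close> unfolding uniformly_stable_def
    by (elim allE[of _ k] impE allE[of _ "length xs"] allE[of _ "xs @ a # ys"]) auto
  have "sup_norm MX (\<lambda>x. \<mu> (T (xs @ a # ys)) x - \<mu> (T (us @ b # vs)) x) \<le>
      sup_norm MX (\<lambda>x. \<mu> (T (xs @ a # ys)) x - \<mu> (T (xs @ ys)) x) +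
      sup_norm MX (\<lambda>x. \<mu> (T (xs @ ys)) x - \<mu> (T (us @ b # vs)) x)"
    using assms(1,2) by (intro sup_norm_diff_triangle) (auto simp: predictor_model_def)
  also have "\<dots> \<le> c k / 2 + c k / 2"
    using delete[of xs a ys] delete[of us b vs] assms by (intro add_mono) (auto simp: sup_norm_diff_commute)
  finally show ?thesis by simp
qed

lemma filter_upt_remove:
  assumes "a \<in> A" "a < n"
  obtains us vs where "filter (\<lambda>j. j \<in> A) [0..<n] = us @ a # vs"
    "filter (\<lambda>j. j \<in> A - {a}) [0..<n] = us @ vs"
proof
  have "[0..<n] = [0..<a] @ a # [Suc a..<n]"
    using assms(2) by (metis le_add_same_cancel1 less_imp_add_positive upt_add_eq_append upt_conv_Cons
        zero_le)
  then show "filter (\<lambda>j. j \<in> A) [0..<n] = filter (\<lambda>j. j \<in> A) [0..<a] @ a # filter (\<lambda>j. j \<in> A) [Suc a..<n]"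
    "filter (\<lambda>j. j \<in> A - {a}) [0..<n] = filter (\<lambda>j. j \<in> A) [0..<a] @ filter (\<lambda>j. j \<in> A) [Suc a..<n]"
    using assms(1) by (auto intro!: arg_cong2[of _ _ _ _ append] filter_cong)
qed

lemma length_filter_upt: "A \<subseteq> {..<n} \<Longrightarrow> length (filter (\<lambda>j. j \<in> A) [0..<n]) = card A"
  by (subst distinct_card[symmetric]) (auto intro!: arg_cong[of _ _ card])

text \<open>
  \<open>T\<close> need not be symmetric. Deleting an index of \<open>A - B\<close> and then inserting one of \<open>B - A\<close> at its
  sorted position keeps the subsample in increasing order of index, so each of the \<open>card (A - B)\<close>
  exchanges costs only one deletion and one insertion.
\<close>

lemma sup_norm_subsample_diff_le:
  assumes mdl: "predictor_model MX \<mu>" "space MX \<noteq> {}" "uniformly_stable MX Y \<mu> T c"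
    and z: "\<And>j. j < n \<Longrightarrow> z j \<in> space MX \<times> Y" and B: "B \<subseteq> {..<n}" "card B = k" and k: "k \<ge> 2"
    and A: "A \<subseteq> {..<n}" "card A = k"
  shows "sup_norm MX (\<lambda>x. \<mu> (T (map z (filter (\<lambda>j. j \<in> A) [0..<n]))) x -
           \<mu> (T (map z (filter (\<lambda>j. j \<in> B) [0..<n]))) x) \<le> real (card (A - B)) * c k"
  using A
proof (induction "card (A - B)" arbitrary: A)
  case 0
  have "finite A" "finite B"
    using 0 B finite_subset by blast+
  then have "A = B"
    using 0 B by (intro card_subset_eq) auto
  then show ?case
    using mdl(2) by (simp add: sup_norm_def)
next
  case (Suc d)
  have fin: "finite A" "finite B"
    using Suc.prems B finite_subset by blast+
  \<comment> \<open>Equal cardinalities guarantee a partner \<open>b\<close> for the index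
    \<open>a\<close> that is exchanged.\<close>
  have "card (B - A) = card (A - B)"
    using fin Suc.prems B by (metis card_Diff_subset_Int Int_commute finite_Int)
  with Suc.hyps(2) obtain a b where a: "a \<in> A - B" and b: "b \<in> B - A"
    by (metis all_not_in_conv card.empty nat.distinct(1))
  define A' where "A' = insert b (A - {a})"
  have "card A > 0"
    using a fin by (auto simp: card_gt_0_iff)
  then have A': "A' \<subseteq> {..<n}" "card A' = k"
    using a b Suc.prems B fin unfolding A'_def by (auto simp: card_insert_if)
  have "A' - B = (A - B) - {a}"
    using a b by (auto simp: A'_def)
  then have d: "d = card (A' - B)"
    using Suc.hyps(2) a fin by simp
  let ?\<mu> = "\<lambda>A. \<mu> (T (map z (filter (\<lambda>j. j \<in> A) [0..<n])))"
  \<comment> \<open>The sorted lists of \<open>A\<close> and \<open>A'\<close> thus agree after one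
    deletion in each, as an exchange requires.\<close>
  have A_eq: "A' - {b} = A - {a}"
    using a b by (auto simp: A'_def)
  obtain us vs where uv: "filter (\<lambda>j. j \<in> A) [0..<n] = us @ a # vs"
      "filter (\<lambda>j. j \<in> A - {a}) [0..<n] = us @ vs"
    using a Suc.prems by (elim filter_upt_remove[of a A n, rotated 2]) auto
  obtain us' vs' where uv': "filter (\<lambda>j. j \<in> A') [0..<n] = us' @ b # vs'"
      "filter (\<lambda>j. j \<in> A - {a}) [0..<n] = us' @ vs'"
    using b B unfolding A_eq[symmetric]
    by (elim filter_upt_remove[of b A' n, rotated 2]) (auto simp: A'_def)
  have len: "length (us @ a # vs) = k" "length (us' @ b # vs') = k"
    using length_filter_upt[of A n] length_filter_upt[of A' n] Suc.prems A' uv uv' by auto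
  have "set (us @ a # vs) \<subseteq> {..<n}" "set (us' @ b # vs') \<subseteq> {..<n}"
    unfolding uv(1)[symmetric] uv'(1)[symmetric] by auto
  then have data: "set (map z (us @ a # vs)) \<subseteq> space MX \<times> Y"
      "set (map z (us' @ b # vs')) \<subseteq> space MX \<times> Y"
    using z by (fastforce simp only: set_map)+
  have "sup_norm MX (\<lambda>x. ?\<mu> A x - ?\<mu> A' x) \<le> c k"
  proof -
    have "map z us @ map z vs = map z us' @ map z vs'"
      using uv(2) uv'(2) by (metis map_append)
    then show ?thesis
      using uniformly_stable_exchange[OF mdl, of "map z us" "z a" "map z vs" k "map z us'" "z b"
          "map z vs'"] len data k unfolding uv uv' by simp
  qed
  moreover have "sup_norm MX (\<lambda>x. ?\<mu> A' x - ?\<mu> B x) \<le> real d * c k"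
    using Suc.hyps(1)[OF d A'] d by simp
  moreover have "sup_norm MX (\<lambda>x. ?\<mu> A x - ?\<mu> B x) \<le>
      sup_norm MX (\<lambda>x. ?\<mu> A x - ?\<mu> A' x) + sup_norm MX (\<lambda>x. ?\<mu> A' x - ?\<mu> B x)"
    using mdl(1,2) by (intro sup_norm_diff_triangle) (auto simp: predictor_model_def)
  ultimately show ?case
    unfolding Suc.hyps(2)[symmetric] by (simp add: algebra_simps)
qed

subsection \<open>Empirical quantiles\<close>

lemma kth_smallest_less_imp:
  assumes "1 \<le> k" "k \<le> size A" "kth_smallest A k < y"
  shows "k \<le> size {#a \<in># A. a < y#}"
proof -
  define xs where "xs = sorted_list_of_multiset A"
  have xs: "sorted xs" "mset xs = A"
    by (simp_all add: xs_def)
  then have len: "length xs = size A"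
    by (metis size_mset)
  have "a < y" if a: "a \<in> set (take k xs)" for a
  proof -
    obtain j where "j < k" "j < length xs" "a = xs ! j"
      using a by (metis in_set_conv_nth length_take min_less_iff_conj nth_take)
    then have "a \<le> xs ! (k - 1)"
      using xs(1) assms len by (auto intro!: sorted_nth_mono)
    then show ?thesis
      using assms(3) by (simp add: kth_smallest_def xs_def)
  qed
  then have "filter (\<lambda>a. a < y) (take k xs) = take k xs"
    by (simp add: filter_id_conv)
  then have "k = length (filter (\<lambda>a. a < y) (take k xs))"
    using assms(2) len by simp
  also have "\<dots> \<le> length (filter (\<lambda>a. a < y) (take k xs @ drop k xs))"
    unfolding filter_append by simp
  also have "\<dots> = size {#a \<in># A. a < y#}"
    by (metis append_take_drop_id mset_filter size_mset xs(2))
  finally show ?thesis .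
qed

text \<open>In the sorted list, the entries from the \<open>k\<close>-th one on number
  \<open>size A + 1 - k\<close>, and none is below the \<open>k\<close>-th.\<close>

lemma less_kth_smallest_imp:
  assumes "1 \<le> k" "k \<le> size A" "y < kth_smallest A k"
  shows "size A + 1 - k \<le> size {#a \<in># A. y < a#}"
proof -
  define xs where "xs = sorted_list_of_multiset A"
  have xs: "sorted xs" "mset xs = A"
    by (simp_all add: xs_def)
  then have len: "length xs = size A"
    by (metis size_mset)
  have "y < a" if a: "a \<in> set (drop (k - 1) xs)" for a
  proof -
    obtain j where j: "j < length (drop (k - 1) xs)" "a = drop (k - 1) xs ! j"
      using a unfolding in_set_conv_nth by blast
    then have "k - 1 + j < length xs" "a = xs ! (k - 1 + j)"
      using assms(1,2) len by simp_all
    then have "xs ! (k - 1) \<le> a"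
      using xs(1) by (auto intro!: sorted_nth_mono)
    then show ?thesis
      using assms(3) by (simp add: kth_smallest_def xs_def)
  qed
  then have "filter (\<lambda>a. y < a) (drop (k - 1) xs) = drop (k - 1) xs"
    by (simp add: filter_id_conv)
  then have "size A + 1 - k = length (filter (\<lambda>a. y < a) (drop (k - 1) xs))"
    using assms(1) len by simp
  also have "\<dots> \<le> length (filter (\<lambda>a. y < a) (take (k - 1) xs @ drop (k - 1) xs))"
    unfolding filter_append by simp
  also have "\<dots> = size {#a \<in># A. y < a#}"
    by (metis append_take_drop_id mset_filter size_mset xs(2))
  finally show ?thesis .
qed

lemma size_filter_image_mset_set:
  "finite I \<Longrightarrow> size {#a \<in># image_mset f (mset_set I). Q a#} = card {i \<in> I. Q (f i)}"
  by (simp add: filter_mset_image_mset)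

text \<open>A value above the quantile forces the quantile to be finite; its rank is then at most
  \<open>size A\<close> and at least \<open>(1 - \<alpha>) * (size A + 1)\<close>.\<close>

lemma quant_up_less_imp:
  assumes "0 < \<alpha>" "\<alpha> < 1" "quant_up \<alpha> A < ereal y"
  shows "(1 - \<alpha>) * real (size A) \<le> real (size {#a \<in># A. a < y#})"
proof -
  define k where "k = nat \<lceil>(1 - \<alpha>) * real (size A + 1)\<rceil>"
  have \<alpha>: "1 \<le> \<alpha> * real (size A + 1)" and "kth_smallest A k < y"
    using assms(3) by (auto simp: quant_up_def k_def field_simps split: if_splits)
  have "0 < (1 - \<alpha>) * real (size A + 1)"
    using assms by (intro mult_pos_pos) auto
  \<comment> \<open>Finiteness means \<open>\<alpha> * (size A + 1) \<ge> 1\<close>, which is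
    exactly what keeps the rank from exceeding \<open>size A\<close>.\<close>
  moreover have "(1 - \<alpha>) * real (size A + 1) \<le> real (size A)"
    using \<alpha> by (simp add: algebra_simps)
  ultimately have k: "1 \<le> k" "k \<le> size A" "(1 - \<alpha>) * real (size A + 1) \<le> real k"
    unfolding k_def by linarith+
  have "(1 - \<alpha>) * real (size A) \<le> (1 - \<alpha>) * real (size A + 1)"
    using assms by (intro mult_left_mono) auto
  with k(3) kth_smallest_less_imp[OF k(1,2) \<open>kth_smallest A k < y\<close>] show ?thesis
    by linarith
qed

text \<open>At least \<open>size A + 1 - k\<close> entries exceed \<open>y\<close>, where
  \<open>k \<le> \<alpha> * (size A + 1)\<close>. The count is the same as for the upper quantile,
  so the two ways of missing the interval can be treated alike.\<close>

lemma less_quant_lo_imp: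
  assumes "0 < \<alpha>" "\<alpha> < 1" "ereal y < quant_lo \<alpha> A"
  shows "(1 - \<alpha>) * real (size A) \<le> real (size {#a \<in># A. y < a#})"
proof -
  define x where "x = \<alpha> * real (size A + 1)"
  define k where "k = nat \<lfloor>x\<rfloor>"
  have "1 \<le> x" and "y < kth_smallest A k"
    using assms(3) by (auto simp: quant_lo_def k_def x_def field_simps split: if_splits)
  moreover have "x < real (size A) + 1"
  proof -
    have "\<alpha> * real (size A + 1) < 1 * real (size A + 1)"
      using assms by (intro mult_strict_right_mono) auto
    then show ?thesis
      unfolding x_def by (simp only: of_nat_add of_nat_1 mult_1_left)
  qed
  ultimately have k: "1 \<le> k" "k \<le> size A" "real k \<le> x"
    unfolding k_def by linarith+
  have "real (size A) + 1 - real k \<le> real (size {#a \<in># A. y < a#})"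
    using less_kth_smallest_imp[OF k(1,2) \<open>y < kth_smallest A k\<close>] k(2) by linarith
  then show ?thesis
    using k(3) assms(2) unfolding x_def by (simp add: algebra_simps)
qed

subsection \<open>Conditional expectations and laws of independent variables\<close>

lemma (in prob_space) subalgebra_vimage_algebra:
  "X \<in> measurable M N \<Longrightarrow> subalgebra M (vimage_algebra (space M) X N)"
  by (auto simp: subalgebra_def sets_vimage_algebra2 measurable_space)

lemma (in prob_space) real_cond_exp_indep:
  assumes indep: "indep_var N X N' W" and B: "B \<in> sets N'"
  shows "AE \<omega> in M. real_cond_exp M (vimage_algebra (space M) X N)
    (indicator (W -` B \<inter> space M)) \<omega> = prob (W -` B \<inter> space M)"
proof -
  have X: "X \<in> measurable M N" and W: "W \<in> measurable M N'"
    using indep by (rule indep_var_rv1, rule indep_var_rv2)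
  interpret finite_measure_subalgebra M "vimage_algebra (space M) X N"
    by unfold_locales (rule subalgebra_vimage_algebra[OF X])
  let ?C = "W -` B \<inter> space M"
  have C: "?C \<in> events"
    using W B by (rule measurable_sets)
  show ?thesis
  proof (rule real_cond_exp_charact)
    fix A assume "A \<in> sets (vimage_algebra (space M) X N)"
    then obtain A' where A': "A' \<in> sets N" "A = X -` A' \<inter> space M"
      using X by (auto simp: sets_vimage_algebra2 measurable_space)
    then have A: "A \<in> events"
      using X by (auto intro: measurable_sets)
    have "(\<integral>\<omega>\<in>A. indicator ?C \<omega> \<partial>M) = prob (A \<inter> ?C)"
      using A C by (simp add: set_lebesgue_integral_def flip: indicator_inter_arith)
    also have "A \<inter> ?C = (\<lambda>\<omega>. (X \<omega>, W \<omega>)) -` (A' \<times> B) \<inter> space M"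
      unfolding A' by auto
    also have "prob \<dots> = prob A * prob ?C"
      unfolding A' by (rule indep_varD[OF indep A'(1) B])
    also have "\<dots> = (\<integral>\<omega>\<in>A. prob ?C \<partial>M)"
      using A by (simp add: set_lebesgue_integral_def)
    finally show "(\<integral>\<omega>\<in>A. indicator ?C \<omega> \<partial>M) = (\<integral>\<omega>\<in>A. prob ?C \<partial>M)" .
  qed (use C in \<open>auto intro!: integrable_real_indicator simp: emeasure_eq_measure\<close>)
qed

text \<open>
  If \<open>A\<close> is not measurable, then \<^const>\<open>real_cond_exp\<close> of its indicator has the junk value \<open>0\<close> almost
  everywhere, so measurability of \<open>A\<close> is not needed for upper bounds.
\<close>

lemma (in prob_space) real_cond_exp_indicator_le:
  assumes sub: "subalgebra M F" and E: "E \<in> sets F" and G: "G \<in> sets M" and "A \<subseteq> space M"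
    and AE_G: "A \<inter> E \<subseteq> G" "AE \<omega> in M. real_cond_exp M F (indicator G) \<omega> = q" and "0 \<le> q"
  shows "AE \<omega> in M. \<omega> \<in> E \<longrightarrow> real_cond_exp M F (indicator A) \<omega> \<le> q"
proof (cases "A \<in> sets M")
  case A [measurable]: True
  interpret finite_measure_subalgebra M F
    by unfold_locales (rule sub)
  have E_M: "E \<in> sets M"
    using E sub by (auto simp: subalgebra_def)
  have "AE \<omega> in M. real_cond_exp M F (\<lambda>\<omega>. indicator E \<omega> * indicator A \<omega>) \<omega> \<le>
      real_cond_exp M F (indicator G) \<omega>"
    using AE_G(1) G E_M A
    by (intro real_cond_exp_mono AE_I2) (auto split: split_indicator intro!: integrable_real_indicator
        simp: emeasure_eq_measure simp flip: indicator_inter_arith)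
  \<comment> \<open>As \<open>E\<close> belongs to \<open>F\<close>, its indicator can be pulled
    out.\<close>
  moreover have "AE \<omega> in M. real_cond_exp M F (\<lambda>\<omega>. indicator E \<omega> * indicator A \<omega>) \<omega> =
      indicator E \<omega> * real_cond_exp M F (indicator A) \<omega>"
    using E E_M A by (intro real_cond_exp_mult) (auto intro!: integrable_real_indicator
        simp: emeasure_eq_measure simp flip: indicator_inter_arith)
  ultimately show ?thesis
    using AE_G(2) by eventually_elim auto
next
  case False
  have "(\<lambda>\<omega>. ennreal (indicator A \<omega>)) \<notin> borel_measurable M"
  proof
    assume "(\<lambda>\<omega>. ennreal (indicator A \<omega>)) \<in> borel_measurable M"
    then have "(\<lambda>\<omega>. ennreal (indicator A \<omega>)) -` {1} \<inter> space M \<in> sets M"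
      by (rule measurable_sets) simp
    also have "(\<lambda>\<omega>. ennreal (indicator A \<omega>)) -` {1} \<inter> space M = A"
      using \<open>A \<subseteq> space M\<close> by (auto simp: indicator_def split: if_splits)
    finally show False using False by simp
  qed
  then have "nn_cond_exp M F (\<lambda>\<omega>. ennreal (indicator A \<omega>)) = (\<lambda>_. 0)"
    by (simp add: nn_cond_exp_def)
  \<comment> \<open>\<open>real_cond_exp\<close> is the difference of the conditional expectations
    of the positive and negative parts; the first vanishes here and the second is
    nonnegative.\<close>
  then have "real_cond_exp M F (indicator A) \<omega> \<le> 0" for \<omega>
    by (simp add: real_cond_exp_def)
  then show ?thesis
    using \<open>0 \<le> q\<close> by (auto intro: order_trans)
qed

text \<open>The joint law is a product measure, and an injective choice of coordinates pushes it
  forward to a product measure. It follows that the data outside a fold, renumbered from 0, are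
  distributed like a fresh sample of their size.\<close>

lemma (in prob_space) distr_indep_vars_reindex:
  assumes "indep_vars (\<lambda>_. N) X I" "I \<noteq> {}" and P: "\<And>i. i \<in> I \<Longrightarrow> distr M N (X i) = P"
    and f: "inj_on f J" "f \<in> J \<rightarrow> I"
  shows "distr M (Pi\<^sub>M J (\<lambda>_. N)) (\<lambda>\<omega>. \<lambda>j\<in>J. X (f j) \<omega>) = Pi\<^sub>M J (\<lambda>_. P)"
proof -
  have X: "X i \<in> measurable M N" if "i \<in> I" for i
    using assms(1) that by (auto simp: indep_vars_def)
  obtain i where i: "i \<in> I"
    using assms(2) by auto
  have "prob_space P" "sets P = sets N"
    using prob_space_distr[OF X[OF i]] P[OF i] by auto
  have sets_Pi: "sets (Pi\<^sub>M K (\<lambda>_. P)) = sets (Pi\<^sub>M K (\<lambda>_. N))" for K :: "'k set"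
    using \<open>sets P = sets N\<close> by (intro sets_PiM_cong) auto
  have "distr M (Pi\<^sub>M I (\<lambda>_. N)) (\<lambda>\<omega>. \<lambda>i\<in>I. X i \<omega>) = Pi\<^sub>M I (\<lambda>i. distr M N (X i))"
    using indep_vars_iff_distr_eq_PiM'[where M' = "\<lambda>_. N", OF assms(2) X] assms(1) by simp
  also have "\<dots> = Pi\<^sub>M I (\<lambda>_. P)"
    by (intro PiM_cong P refl)
  finally have law: "Pi\<^sub>M I (\<lambda>_. P) = distr M (Pi\<^sub>M I (\<lambda>_. N)) (\<lambda>\<omega>. \<lambda>i\<in>I. X i \<omega>)" ..
  have "Pi\<^sub>M J (\<lambda>_. P) = distr (Pi\<^sub>M I (\<lambda>_. P)) (Pi\<^sub>M J (\<lambda>_. P)) (\<lambda>\<omega>. \<lambda>j\<in>J. \<omega> (f j))"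
    using distr_PiM_reindex[of I "\<lambda>_. P" f J] \<open>prob_space P\<close> f by simp
  also have "\<dots> = distr (Pi\<^sub>M I (\<lambda>_. P)) (Pi\<^sub>M J (\<lambda>_. N)) (\<lambda>\<omega>. \<lambda>j\<in>J. \<omega> (f j))"
    using \<open>sets P = sets N\<close> by (intro distr_cong sets_PiM_cong) auto
  also have "\<dots> = distr M (Pi\<^sub>M J (\<lambda>_. N)) ((\<lambda>\<omega>. \<lambda>j\<in>J. \<omega> (f j)) \<circ> (\<lambda>\<omega>. \<lambda>i\<in>I. X i \<omega>))"
    unfolding law using f X
    by (intro distr_distr measurable_restrict measurable_component_singleton) auto
  also have "\<dots> = distr M (Pi\<^sub>M J (\<lambda>_. N)) (\<lambda>\<omega>. \<lambda>j\<in>J. X (f j) \<omega>)"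
    using f by (intro distr_cong) (auto simp: fun_eq_iff restrict_def Pi_iff)
  finally show ?thesis ..
qed

text \<open>The count is a sum of independent indicators with values in \<open>[0, 1]\<close>, so
  this is Hoeffding's inequality with deviation \<open>n * s\<close>.\<close>

lemma (in prob_space) indep_vars_count_le:
  assumes ind: "indep_vars (\<lambda>_. N) X {..<n}" and "n > 0" "0 \<le> s"
    and B: "B \<in> sets N" and prob_B: "\<And>i. i < n \<Longrightarrow> prob (X i -` B \<inter> space M) = u"
  shows "prob {\<omega> \<in> space M. real (card {i \<in> {..<n}. X i \<omega> \<in> B}) \<ge> real n * (u + s)} \<le>
    exp (- 2 * real n * s\<^sup>2)"
proof -
  have X: "X i \<in> measurable M N" if "i < n" for i
    using ind that by (auto simp: indep_vars_def)
  define J where "J i \<omega> = (indicator B (X i \<omega>) :: real)" for i \<omega>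
  interpret Hoeffding_ineq M "{..<n}" J "\<lambda>_. 0" "\<lambda>_. 1" "\<Sum>i<n. expectation (J i)"
  proof unfold_locales
    show "indep_vars (\<lambda>_. borel) J {..<n}"
      unfolding J_def using B by (intro indep_vars_compose2[OF ind]) auto
  qed (auto simp: J_def split: split_indicator)
  have "expectation (J i) = u" if "i < n" for i
  proof -
    have "expectation (J i) = expectation (indicator (X i -` B \<inter> space M))"
      unfolding J_def by (intro Bochner_Integration.integral_cong) (auto split: split_indicator)
    also have "\<dots> = u"
      using prob_B[OF that] measurable_sets[OF X[OF that] B] by simp
    finally show ?thesis .
  qed
  then have mean: "(\<Sum>i<n. expectation (J i)) = real n * u"
    by simp
  have "(\<Sum>i<n. J i \<omega>) = real (card {i \<in> {..<n}. X i \<omega> \<in> B})" for \<omega>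
    by (simp add: J_def indicator_def sum.If_cases Int_def flip: of_nat_sum)
  then have "prob {\<omega> \<in> space M. real (card {i \<in> {..<n}. X i \<omega> \<in> B}) \<ge> real n * (u + s)} =
      prob {\<omega> \<in> space M. (\<Sum>i<n. J i \<omega>) \<ge> (\<Sum>i<n. expectation (J i)) + real n * s}"
    by (simp add: mean algebra_simps)
  also have "\<dots> \<le> exp (- 2 * (real n * s)\<^sup>2 / (\<Sum>i<n. (1 - 0)\<^sup>2))"
    using assms by (intro Hoeffding_ineq_ge) auto
  also have "- 2 * (real n * s)\<^sup>2 / (\<Sum>i<n. (1 - 0)\<^sup>2) = - 2 * real n * s\<^sup>2"
    using \<open>n > 0\<close> by (simp add: power2_eq_square)
  finally show ?thesis .
qed

subsection \<open>Residuals and fits\<close>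

lemma has_density_increment_le:
  assumes F: "has_density F f" and B: "\<And>t. f t \<le> B" and "s \<le> t"
  shows "F t - F s \<le> B * (t - s)"
proof -
  have int: "set_integrable lborel {..t} f" and f: "f \<in> borel_measurable borel"
    using F by (auto simp: has_density_def)
  have int_I: "set_integrable lborel {s<..t} f"
    by (rule set_integrable_subset[OF int]) auto
  have "F t = (LINT u:{..s} \<union> {s<..t}|lborel. f u)"
    using F \<open>s \<le> t\<close> by (simp add: has_density_def ivl_disj_un)
  also have "\<dots> = (LINT u:{..s}|lborel. f u) + (LINT u:{s<..t}|lborel. f u)"
    using F int_I by (intro set_integral_Un) (auto simp: has_density_def)
  also have "(LINT u:{..s}|lborel. f u) = F s"
    using F by (simp add: has_density_def)
  also have "(LINT u:{s<..t}|lborel. f u) \<le> (LINT u:{s<..t}|lborel. B)"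
    using int_I B \<open>s \<le> t\<close>
    by (intro set_integral_mono) (auto simp: set_integrable_def integrable_real_indicator)
  also have "\<dots> = B * (t - s)"
    using \<open>s \<le> t\<close> by (simp add: set_lebesgue_integral_def)
  finally show ?thesis by simp
qed

text \<open>The bounded density makes the distribution function Lipschitz, hence continuous. It
  vanishes at \<open>- 1\<close>, because residuals are nonnegative, and tends to 1, so every level
  in between is attained exactly.\<close>

lemma resid_cdf_intermediate:
  assumes P: "prob_space P" and R: "(\<lambda>z. snd z - \<mu> (mean_param P T k) (fst z)) \<in> borel_measurable P"
    and F: "has_density (resid_cdf P \<mu> T k) f" "\<And>t. f t \<le> B" and u: "0 < u" "u < 1"
  shows "\<exists>r. resid_cdf P \<mu> T k r = u"
proof -
  let ?F = "resid_cdf P \<mu> T k"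
  interpret prob_space P by (rule P)
  let ?R = "\<lambda>z. \<bar>snd z - \<mu> (mean_param P T k) (fst z)\<bar>"
  have R' [measurable]: "?R \<in> borel_measurable P"
    using R by (rule borel_measurable_abs)
  interpret D: real_distribution "distr P borel ?R"
    by simp
  have F_eq: "?F = cdf (distr P borel ?R)"
    by (auto simp: cdf_def2 resid_cdf_def measure_distr vimage_def Int_def conj_commute)
  have mono: "?F s \<le> ?F t" if "s \<le> t" for s t
    unfolding F_eq using that by (rule D.cdf_nondecreasing)
  have "0 \<le> B"
    using F by (metis has_density_def order_trans)
  have "\<bar>?F t - ?F s\<bar> \<le> B * \<bar>t - s\<bar>" for s t
    using has_density_increment_le[OF F, of s t] has_density_increment_le[OF F, of t s]
      mono[of s t] mono[of t s] by (cases "s \<le> t") auto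
  then have "B-lipschitz_on UNIV ?F"
    using \<open>0 \<le> B\<close> by (intro lipschitz_onI) (auto simp: dist_real_def)
  then have cont: "continuous_on UNIV ?F"
    by (rule lipschitz_on_continuous_on)
  have "eventually (\<lambda>t. u < ?F t) at_top"
    unfolding F_eq by (rule order_tendstoD(1)[OF D.cdf_lim_at_top_prob u(2)])
  then obtain t where t: "u < ?F t" "0 \<le> t"
    by (metis eventually_at_top_linorder linorder_le_cases order_refl)
  have "\<not> \<bar>a\<bar> \<le> - 1" for a :: real
    by linarith
  then have "?F (- 1) = 0"
    by (simp add: resid_cdf_def)
  then show ?thesis
    using IVT'[of ?F "- 1" u t] t u continuous_on_subset[OF cont] by auto
qed

lemma space_data_space: "space (data_space MX Y) = space MX \<times> Y"
  by (simp add: data_space_def space_pair_measure space_restrict_space)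

text \<open>Missing the interval on either side yields at least \<open>(1 - \<alpha>) * n\<close>
  indices whose residual is below the distance from \<open>y\<close> to the corresponding fit.
  Passing from the fits to \<open>\<mu> b\<close> costs \<open>\<eta>\<close> at the training point
  and \<open>\<eta>\<close> at the test point. If the conclusion failed, all these indices would
  have a residual with respect to \<open>\<mu> b\<close> of at most \<open>r\<close>, which is too
  many.\<close>

lemma cv_plus_miscoverage_imp:
  fixes z :: "nat \<Rightarrow> 'x \<times> real" and \<mu> :: "real ^ 'p \<Rightarrow> 'x \<Rightarrow> real"
  assumes "0 < \<alpha>" "\<alpha> < 1"
    and fit: "\<And>i x. i < n \<Longrightarrow> x \<in> space MX \<Longrightarrow>
      \<bar>\<mu> (fit_without T n (S (fold_index K S i)) z) x - \<mu> b x\<bar> \<le> \<eta>"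
    and z: "\<And>i. i < n \<Longrightarrow> fst (z i) \<in> space MX" and x: "x \<in> space MX"
    and few: "real (card {i \<in> {..<n}. \<bar>snd (z i) - \<mu> b (fst (z i))\<bar> \<le> r}) < (1 - \<alpha>) * real n"
    and y: "y \<notin> cv_plus_interval \<mu> T n K S \<alpha> z x"
  shows "r - 2 * \<eta> < \<bar>y - \<mu> b x\<bar>"
proof -
  let ?fit = "\<lambda>i. \<mu> (fit_without T n (S (fold_index K S i)) z) x"
  let ?R = "cv_residual \<mu> T n K S z"
  let ?R' = "\<lambda>i. \<bar>snd (z i) - \<mu> b (fst (z i))\<bar>"
  have close: "?R' i - \<eta> \<le> ?R i" if "i < n" for i
    using fit[OF that z[OF that]] unfolding cv_residual_def by linarith
  have "quant_up \<alpha> {# ?fit i + ?R i. i \<in># mset_set {..<n} #} < ereal y \<or>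
      ereal y < quant_lo \<alpha> {# ?fit i - ?R i. i \<in># mset_set {..<n} #}"
    using y by (auto simp: cv_plus_interval_def not_le)
  then have "(1 - \<alpha>) * real n \<le> real (card {i \<in> {..<n}. ?fit i + ?R i < y}) \<or>
      (1 - \<alpha>) * real n \<le> real (card {i \<in> {..<n}. y < ?fit i - ?R i})"
  proof
    assume "quant_up \<alpha> {# ?fit i + ?R i. i \<in># mset_set {..<n} #} < ereal y"
    from quant_up_less_imp[OF assms(1,2) this] show ?thesis
      by (simp add: size_filter_image_mset_set)
  next
    assume "ereal y < quant_lo \<alpha> {# ?fit i - ?R i. i \<in># mset_set {..<n} #}"
    from less_quant_lo_imp[OF assms(1,2) this] show ?thesis
      by (simp add: size_filter_image_mset_set)
  qed
  then obtain I where I: "I \<subseteq> {..<n}" "(1 - \<alpha>) * real n \<le> real (card I)"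
      and R_less: "\<And>i. i \<in> I \<Longrightarrow> ?R i < \<bar>y - ?fit i\<bar>"
  proof
    assume "(1 - \<alpha>) * real n \<le> real (card {i \<in> {..<n}. ?fit i + ?R i < y})"
    then show thesis by (rule that[rotated]) auto
  next
    assume "(1 - \<alpha>) * real n \<le> real (card {i \<in> {..<n}. y < ?fit i - ?R i})"
    then show thesis by (rule that[rotated]) auto
  qed
  show ?thesis
  proof (rule ccontr)
    assume neg: "\<not> ?thesis"
    have "?R' i \<le> r" if "i \<in> I" for i
    proof -
      have "i < n" using I(1) that by auto
      from fit[OF this x] close[OF this] R_less[OF that] neg show ?thesis by linarith
    qed
    then have "card I \<le> card {i \<in> {..<n}. ?R' i \<le> r}"
      using I(1) by (intro card_mono) auto
    with I(2) few show False by linarith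
  qed
qed

section \<open>Concentration of the fitted parameter around its mean\<close>

lemma infnorm_gt_imp_component:
  fixes x :: "real ^ 'n"
  assumes "infnorm x > t"
  shows "\<exists>j. \<bar>x $ j\<bar> \<ge> t"
proof (rule ccontr)
  assume "\<not> ?thesis"
  then have "infnorm x \<le> t"
    unfolding infnorm_cart by (intro cSup_least) (auto simp: not_le intro: less_imp_le)
  with assms show False by simp
qed

text \<open>One exchanged data point moves the predictor by at most \<open>c k\<close>, hence each
  coordinate of the parameter by at most \<open>c k / \<kappa>\<^sub>1\<close>. McDiarmid's
  inequality and a union bound over the coordinates finish the proof.\<close>

lemma training_concentration:
  fixes \<mu> :: "real ^ 'p \<Rightarrow> 'x \<Rightarrow> real"
  assumes mdl: "predictor_model MX \<mu>" "space MX \<noteq> {}" "uniformly_stable MX Y \<mu> T c"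
    and T: "training_algorithm MX Y T"
    and P: "prob_space P" "sets P = sets (data_space MX Y)"
    and k: "k \<ge> 2" and c: "0 < c k" and \<kappa>: "0 < \<kappa>\<^sub>1" "bi_lipschitz MX \<mu> \<kappa>\<^sub>1 \<kappa>\<^sub>2"
    and \<epsilon>: "0 < \<epsilon>" "\<epsilon> < 2 * real CARD('p)"
  shows "measure (Pi\<^sub>M {..<k} (\<lambda>_. P)) {z \<in> space (Pi\<^sub>M {..<k} (\<lambda>_. P)).
      infnorm (T (map z [0..<k]) - mean_param P T k) >
        c k * sqrt (real k / (2 * \<kappa>\<^sub>1\<^sup>2) * ln (2 * real CARD('p) / \<epsilon>))} \<le> \<epsilon>"
proof -
  define Q where "Q = Pi\<^sub>M {..<k} (\<lambda>_. P)"
  define t where "t = c k * sqrt (real k / (2 * \<kappa>\<^sub>1\<^sup>2) * ln (2 * real CARD('p) / \<epsilon>))"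
  define f where "f j z = T (map z [0..<k]) $ j" for j z
  interpret Q: prob_space Q
    unfolding Q_def by (rule prob_space_PiM) (rule P)
  have ln_pos: "ln (2 * real CARD('p) / \<epsilon>) > 0"
    using \<epsilon> by simp
  then have t: "t > 0"
    using k c \<kappa> by (simp add: t_def)
  have sets_Q: "sets Q = sets (Pi\<^sub>M {..<k} (\<lambda>_. data_space MX Y))"
    unfolding Q_def using P by (intro sets_PiM_cong) auto
  have "(\<lambda>z. T (map z [0..<k])) \<in> borel_measurable Q"
    using T k unfolding training_algorithm_def measurable_cong_sets[OF sets_Q refl] by auto
  then have f: "f j \<in> borel_measurable Q" for j
    unfolding f_def
    by (rule measurable_compose) (intro borel_measurable_continuous_onI continuous_intros)
  have diff: "bounded_differences {..<k} (\<lambda>_. P) (\<lambda>_. c k / \<kappa>\<^sub>1) (f j)" for j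
    unfolding bounded_differences_def
  proof (intro ballI)
    fix z i y assume z: "z \<in> space (Pi\<^sub>M {..<k} (\<lambda>_. P))" and i: "i \<in> {..<k}" and y: "y \<in> space P"
    have space_P: "space P = space MX \<times> Y"
      using sets_eq_imp_space_eq[OF P(2)] by (simp add: space_data_space)
    have zj: "z j \<in> space MX \<times> Y" if "j < k" for j
      using z that space_P by (auto simp: space_PiM PiE_iff)
    have split: "[0..<k] = [0..<i] @ i # [Suc i..<k]"
      using i by (metis lessThan_iff le_add_same_cancel1 less_imp_add_positive upt_add_eq_append
          upt_conv_Cons zero_le)
    have upd: "map (z(i := y)) [0..<k] = map z [0..<i] @ y # map z [Suc i..<k]"
      unfolding split by simp
    have "\<kappa>\<^sub>1 * infnorm (T (map (z(i := y)) [0..<k]) - T (map z [0..<k])) \<le>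
        sup_norm MX (\<lambda>x. \<mu> (T (map (z(i := y)) [0..<k])) x - \<mu> (T (map z [0..<k])) x)"
      using \<kappa>(2) by (simp add: bi_lipschitz_def)
    also have "\<dots> \<le> c k"
      unfolding upd unfolding split list.map map_append
    proof (rule uniformly_stable_exchange[OF mdl])
      have "set (map z [0..<i]) \<subseteq> space MX \<times> Y" "set (map z [Suc i..<k]) \<subseteq> space MX \<times> Y"
        using i zj by (auto simp: image_subset_iff simp del: mem_Sigma_iff)
      then show "set (map z [0..<i] @ y # map z [Suc i..<k]) \<subseteq> space MX \<times> Y"
          "set (map z [0..<i] @ z i # map z [Suc i..<k]) \<subseteq> space MX \<times> Y"
        using i y space_P zj by simp_all
    qed (use i k in auto)
    finally have "infnorm (T (map (z(i := y)) [0..<k]) - T (map z [0..<k])) \<le> c k / \<kappa>\<^sub>1"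
      using \<kappa>(1) by (simp add: field_simps)
    then show "\<bar>f j (z(i := y)) - f j z\<bar> \<le> c k / \<kappa>\<^sub>1"
      using component_le_infnorm_cart[of "T (map (z(i := y)) [0..<k]) - T (map z [0..<k])" j]
      by (simp add: f_def)
  qed
  have sum_c: "(\<Sum>i<k. (c k / \<kappa>\<^sub>1)\<^sup>2) = real k * (c k / \<kappa>\<^sub>1)\<^sup>2"
    by simp
  have "{z \<in> space Q. infnorm (T (map z [0..<k]) - mean_param P T k) > t} \<subseteq>
      (\<Union>j. {z \<in> space Q. \<bar>f j z - (\<integral>z. f j z \<partial>Q)\<bar> \<ge> t})"
    by (auto dest!: infnorm_gt_imp_component simp: mean_param_def f_def Q_def)
  then have "Q.prob {z \<in> space Q. infnorm (T (map z [0..<k]) - mean_param P T k) > t} \<le>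
      Q.prob (\<Union>j. {z \<in> space Q. \<bar>f j z - (\<integral>z. f j z \<partial>Q)\<bar> \<ge> t})"
    using f by (intro Q.finite_measure_mono sets.finite_UN) (auto intro!: borel_measurable_le)
  also have "\<dots> \<le> (\<Sum>j\<in>UNIV. Q.prob {z \<in> space Q. \<bar>f j z - (\<integral>z. f j z \<partial>Q)\<bar> \<ge> t})"
    using f by (intro Q.finite_measure_subadditive_finite) auto
  also have "\<dots> \<le> (\<Sum>j\<in>(UNIV :: 'p set). 2 * exp (- 2 * t\<^sup>2 / (\<Sum>i<k. (c k / \<kappa>\<^sub>1)\<^sup>2)))"
  proof (rule sum_mono)
    fix j
    show "Q.prob {z \<in> space Q. \<bar>f j z - (\<integral>z. f j z \<partial>Q)\<bar> \<ge> t} \<le>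
        2 * exp (- 2 * t\<^sup>2 / (\<Sum>i<k. (c k / \<kappa>\<^sub>1)\<^sup>2))"
      unfolding Q_def using f[of j] diff[of j] t c \<kappa> k P
      by (intro McDiarmid_ineq_abs_ge) (auto simp: Q_def)
  qed
  \<comment> \<open>The threshold \<open>t\<close> is chosen for this exponent, so that each of the
    \<open>CARD('p)\<close> coordinates contributes \<open>\<epsilon> / CARD('p)\<close>.\<close>
  also have "- 2 * t\<^sup>2 / (\<Sum>i<k. (c k / \<kappa>\<^sub>1)\<^sup>2) = - ln (2 * real CARD('p) / \<epsilon>)"
    unfolding sum_c t_def using ln_pos k c \<kappa>(1)
    by (simp add: power_mult_distrib power_divide divide_simps)
  also have "(\<Sum>j\<in>(UNIV :: 'p set). 2 * exp (- ln (2 * real CARD('p) / \<epsilon>))) = \<epsilon>"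
    using \<epsilon> by (simp add: exp_minus)
  finally show ?thesis
    unfolding Q_def t_def .
qed

section \<open>Comparison of the fits without different folds\<close>

lemma fold_index_eq:
  assumes "folds n K m S" "i < n"
  shows "fold_index K S i < K" "i \<in> S (fold_index K S i)"
proof -
  have "\<exists>!k. k < K \<and> i \<in> S k"
    using assms unfolding folds_def disjoint_family_on_def by (auto 0 4)
  then have "fold_index K S i < K \<and> i \<in> S (fold_index K S i)"
    unfolding fold_index_def by (rule theI')
  then show "fold_index K S i < K" "i \<in> S (fold_index K S i)" by auto
qed

lemma fit_without_eq:
  "fit_without T n B z = T (map z (filter (\<lambda>j. j \<in> {..<n} - B) [0..<n]))"
  unfolding fit_without_def by (intro arg_cong[of _ _ T] arg_cong[of _ _ "map z"] filter_cong) auto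

text \<open>The complements of two folds have equal size and differ by at most \<open>m\<close>
  exchanges, each moving the predictor by at most \<open>c (n - m)\<close>; the lower Lipschitz
  bound converts this to parameters.\<close>

lemma fit_without_infnorm_diff_le:
  fixes \<mu> :: "real ^ 'p \<Rightarrow> 'x \<Rightarrow> real"
  assumes mdl: "predictor_model MX \<mu>" "space MX \<noteq> {}" "uniformly_stable MX Y \<mu> T c"
    and \<kappa>: "0 < \<kappa>\<^sub>1" "bi_lipschitz MX \<mu> \<kappa>\<^sub>1 \<kappa>\<^sub>2"
    and z: "\<And>j. j < n \<Longrightarrow> z j \<in> space MX \<times> Y"
    and AB: "A \<subseteq> {..<n}" "B \<subseteq> {..<n}" "card A = m" "card B = m" and "n - m \<ge> 2" "0 < c (n - m)"
  shows "infnorm (fit_without T n A z - fit_without T n B z) \<le> real m * c (n - m) / \<kappa>\<^sub>1"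
proof -
  have fin: "finite A" "finite B"
    using AB finite_subset by blast+
  have "\<kappa>\<^sub>1 * infnorm (fit_without T n A z - fit_without T n B z) \<le>
      sup_norm MX (\<lambda>x. \<mu> (fit_without T n A z) x - \<mu> (fit_without T n B z) x)"
    using \<kappa>(2) by (simp add: bi_lipschitz_def)
  also have "\<dots> \<le> real (card (({..<n} - A) - ({..<n} - B))) * c (n - m)"
    unfolding fit_without_eq using assms fin
    by (intro sup_norm_subsample_diff_le[OF mdl z]) (auto simp: card_Diff_subset)
  also have "\<dots> \<le> real m * c (n - m)"
  proof -
    have "card (({..<n} - A) - ({..<n} - B)) \<le> card B"
      using fin by (intro card_mono) auto
    then show ?thesis
      using AB assms by (intro mult_right_mono) auto
  qed
  finally show ?thesis
    using \<kappa>(1) by (simp add: field_simps)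
qed

section \<open>The training-conditional miscoverage bound\<close>

theorem corollary1:
  fixes M :: "'w measure"
    and MX :: "'x measure"
    and Y :: "real set"
    and P :: "('x \<times> real) measure"
    and Z :: "nat \<Rightarrow> 'w \<Rightarrow> 'x \<times> real"
    and \<mu> :: "real ^ 'p \<Rightarrow> 'x \<Rightarrow> real"
    and T :: "('x \<times> real) list \<Rightarrow> real ^ 'p"
    and c L :: "nat \<Rightarrow> real"
    and \<kappa>\<^sub>1 \<kappa>\<^sub>2 \<alpha> \<epsilon> \<delta> :: real
    and n K m :: nat
    and S :: "nat \<Rightarrow> nat set"
  assumes "K \<ge> 2" and "m \<ge> 1" and "n = K * m" and "n - m \<ge> 2"
    and "folds n K m S"
    and "0 < \<alpha>" and "\<alpha> < 1"
    and "Y \<in> sets borel"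
    and "predictor_model MX \<mu>"
    and "training_algorithm MX Y T"
    and "prob_space M"
    and "prob_space.indep_vars M (\<lambda>_. data_space MX Y) Z {..n}"
    and "\<And>i. i \<le> n \<Longrightarrow> distr M (data_space MX Y) (Z i) = P"
    and "\<And>k. k \<ge> 1 \<Longrightarrow> 0 < c k"
    and "uniformly_stable MX Y \<mu> T c"
    and "0 < \<kappa>\<^sub>1"
    and "bi_lipschitz MX \<mu> \<kappa>\<^sub>1 \<kappa>\<^sub>2"
    and "bounded_density P \<mu> T L"
    and "0 < \<epsilon>" and "0 < \<delta>"
  shows "measure M {\<omega> \<in> space M.
      cv_plus_miscoverage M (data_space MX Y) \<mu> T n K S \<alpha> Z \<omega> >
        \<alpha> + sqrt (ln (2 / \<delta>) / (2 * real n))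
          + 2 * real m * L (n - m) * \<kappa>\<^sub>2 * c (n - m) *
            (1 / \<kappa>\<^sub>1 + sqrt (real n / (2 * \<kappa>\<^sub>1\<^sup>2) * ln (2 * real CARD('p) / \<epsilon>)))}
    \<le> \<epsilon> + \<delta>"
proof -
  interpret prob_space M by fact
  define N where "N = data_space MX Y"
  define k where "k = n - m"
  define F where "F = train_sigma M N n Z"
  define A where "A = {\<omega> \<in> space M.
    snd (Z n \<omega>) \<notin> cv_plus_interval \<mu> T n K S \<alpha> (\<lambda>i. Z i \<omega>) (fst (Z n \<omega>))}"
  define l where "l = ln (2 * real CARD('p) / \<epsilon>)"
  define s where "s = sqrt (ln (2 / \<delta>) / (2 * real n))"
  \<comment> \<open>The summand \<open>1 / \<kappa>\<^sub>1\<close> accounts for the passage between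
    folds, the root for the McDiarmid deviation; \<open>\<kappa>\<^sub>2\<close> turns distances of
    parameters into distances of predictors.\<close>
  define \<eta> where "\<eta> = real m * \<kappa>\<^sub>2 * c k * (1 / \<kappa>\<^sub>1 + sqrt (real n / (2 * \<kappa>\<^sub>1\<^sup>2) * l))"
  define b where "b = mean_param P T k"
  define R where "R z = \<bar>snd z - \<mu> b (fst z)\<bar>" for z
  define bad where "bad = {\<omega> \<in> space M. real_cond_exp M F (indicator A) \<omega> > \<alpha> + s + 2 * L k * \<eta>}"
  have bad_eq: "bad = {\<omega> \<in> space M.
      cv_plus_miscoverage M (data_space MX Y) \<mu> T n K S \<alpha> Z \<omega> >
        \<alpha> + sqrt (ln (2 / \<delta>) / (2 * real n))
          + 2 * real m * L (n - m) * \<kappa>\<^sub>2 * c (n - m) *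
            (1 / \<kappa>\<^sub>1 + sqrt (real n / (2 * \<kappa>\<^sub>1\<^sup>2) * ln (2 * real CARD('p) / \<epsilon>)))}"
    unfolding bad_def cv_plus_miscoverage_def A_def F_def N_def s_def \<eta>_def l_def k_def
    by (simp add: mult_ac)
  have k: "k \<ge> 2" and n: "n > 0" "k \<le> n" and m: "m \<ge> 1" and ck: "0 < c k"
    using assms(1-4,14) by (auto simp: k_def)
  have Z [measurable]: "Z i \<in> measurable M N" if "i \<le> n" for i
    using assms(12) that by (auto simp: indep_vars_def N_def)
  have P: "prob_space P" "sets P = sets N"
    using prob_space_distr[OF Z[of n]] assms(13)[of n] by (auto simp: N_def)
  have Z_space: "Z i \<omega> \<in> space MX \<times> Y" if "i \<le> n" "\<omega> \<in> space M" for i \<omega>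
    using measurable_space[OF Z[OF that(1)] that(2)] by (simp add: N_def space_data_space)
  then have MX: "space MX \<noteq> {}"
    using not_empty by (metis SigmaE empty_iff ex_in_conv order_refl)
  have R [measurable]: "R \<in> borel_measurable N" "(\<lambda>z. snd z - \<mu> b (fst z)) \<in> borel_measurable N"
  proof -
    have "\<mu> b \<in> borel_measurable MX"
      using assms(9) by (simp add: predictor_model_def)
    moreover have "snd \<in> borel_measurable N"
      unfolding N_def data_space_def
      by (rule measurable_compose[OF measurable_snd measurable_restrict_space1]) simp
    moreover have "fst \<in> measurable N MX"
      unfolding N_def data_space_def by simp
    ultimately show "(\<lambda>z. snd z - \<mu> b (fst z)) \<in> borel_measurable N"
      by measurable
    then show "R \<in> borel_measurable N"
      unfolding R_def by (rule borel_measurable_abs)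
  qed
  \<comment> \<open>Positivity follows by comparing both Lipschitz bounds at the distinct parameters
    1 and 0.\<close>
  have \<kappa>\<^sub>2: "0 < \<kappa>\<^sub>2"
  proof -
    have "infnorm (1 - 0 :: real ^ 'p) > 0"
      by (simp add: infnorm_pos_lt)
    moreover have "\<kappa>\<^sub>1 * infnorm (1 - 0 :: real ^ 'p) \<le> \<kappa>\<^sub>2 * infnorm (1 - 0 :: real ^ 'p)"
      using assms(17) unfolding bi_lipschitz_def by (meson order_trans)
    ultimately show ?thesis
      using assms(16) by (simp add: mult_le_cancel_right)
  qed
  obtain f where f: "has_density (resid_cdf P \<mu> T k) f" "\<And>t. f t \<le> L k"
    using assms(18) k unfolding bounded_density_def by (metis less_imp_le one_le_numeral order_trans)
  have L: "0 \<le> L k"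
    using f by (metis has_density_def order_trans)
  have X: "(\<lambda>\<omega>. \<lambda>i\<in>{..<n}. Z i \<omega>) \<in> measurable M (Pi\<^sub>M {..<n} (\<lambda>_. N))"
    by (intro measurable_restrict Z) auto
  have sub: "subalgebra M F"
    unfolding F_def train_sigma_def by (rule subalgebra_vimage_algebra[OF X])
  have space_F: "space F = space M"
    using sub by (simp add: subalgebra_def)
  have Z_F: "Z i \<in> measurable F N" if "i < n" for i
  proof -
    have "(\<lambda>\<omega>. \<lambda>i\<in>{..<n}. Z i \<omega>) \<in> measurable F (Pi\<^sub>M {..<n} (\<lambda>_. N))"
      unfolding F_def train_sigma_def
      using measurable_space[OF X] by (intro measurable_vimage_algebra1 Pi_I)
    then have "(\<lambda>\<omega>. (\<lambda>i\<in>{..<n}. Z i \<omega>) i) \<in> measurable F N"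
      by (rule measurable_compose) (use that in simp)
    then show ?thesis
      using that by simp
  qed
  interpret F: finite_measure_subalgebra M F
    by unfold_locales (rule sub)

  have "prob bad \<le> \<epsilon> + \<delta>"
  proof (cases "\<epsilon> < 1 \<and> \<delta> < 1")
    \<comment> \<open>Here the right-hand side is at least 1. In the other case both logarithms are
      positive.\<close>
    case False
    then show ?thesis
      using prob_le_1[of bad] assms(19,20) by linarith
  next
    case True
    have "1 \<le> real CARD('p)"
      by (simp add: Suc_le_eq)
    then have \<epsilon>: "\<epsilon> < 2 * real CARD('p)"
      using True by linarith
    have l: "l > 0"
      using \<epsilon> assms(19) by (simp add: l_def)
    have s: "s > 0" "s\<^sup>2 = ln (2 / \<delta>) / (2 * real n)"
      using True assms(20) n by (simp_all add: s_def)
    have \<eta>: "0 \<le> \<eta>"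
      unfolding \<eta>_def using \<kappa>\<^sub>2 ck assms(16) l by simp
    show ?thesis
    proof (cases "1 - \<alpha> - s > 0")
      \<comment> \<open>The threshold is now at least 1, and a conditional probability exceeds 1
        only on a null set.\<close>
      case False
      have top: "space M \<in> sets F"
        using sets.top[of F] by (simp add: space_F)
      have "integrable M (indicator (space M) :: _ \<Rightarrow> real)"
        by (intro integrable_real_indicator) (auto simp: emeasure_eq_measure)
      then have "AE \<omega> in M. real_cond_exp M F (indicator (space M)) \<omega> = indicator (space M) \<omega>"
        by (rule F.real_cond_exp_F_meas) (rule borel_measurable_indicator[OF top])
      then have "AE \<omega> in M. real_cond_exp M F (indicator (space M)) \<omega> = 1"
        using AE_space by eventually_elim simp
      then have AE1: "AE \<omega> in M. \<omega> \<in> space M \<longrightarrow> real_cond_exp M F (indicator A) \<omega> \<le> 1"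
        by (intro real_cond_exp_indicator_le[OF sub top]) (auto simp: A_def)
      have thr: "1 \<le> \<alpha> + s + 2 * L k * \<eta>"
        using False L \<eta> by (smt (verit) mult_nonneg_nonneg)
      from AE1 have "AE \<omega> in M. \<omega> \<in> bad \<longrightarrow> \<omega> \<in> {}"
        unfolding bad_def by (elim eventually_mono) (use thr in auto)
      then have "prob bad \<le> prob {}"
        by (intro finite_measure_mono_AE) auto
      then show ?thesis
        using assms(19,20) by simp
    next
      case u: True
      \<comment> \<open>Since the level is attained exactly, Hoeffding's deviation \<open>s\<close>
        leads precisely to the fraction \<open>1 - \<alpha>\<close>, and the tail beyond
        \<open>r\<close> is precisely \<open>\<alpha> + s\<close>.\<close>
      obtain r where r: "resid_cdf P \<mu> T k r = 1 - \<alpha> - s"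
        using resid_cdf_intermediate[OF P(1) _ f, of "1 - \<alpha> - s"] u s assms(6,7) R(2)
        unfolding b_def measurable_cong_sets[OF P(2) refl] by fastforce
      have law: "prob (Z i -` B \<inter> space M) = measure P B" if "i \<le> n" "B \<in> sets N" for i B
        using measure_distr[OF Z[OF that(1)] that(2)] assms(13)[OF that(1)] by (simp add: N_def)
      have cdf: "resid_cdf P \<mu> T k t = measure P {z \<in> space N. R z \<le> t}" for t
        using sets_eq_imp_space_eq[OF P(2)] by (simp add: resid_cdf_def R_def b_def)
      \<comment> \<open>\<open>E1\<close> and \<open>E2\<close> are determined by the training data;
        they have to lie in \<open>F\<close> to be pulled out of the conditional
        expectation.\<close>
      define E1 where "E1 = {\<omega> \<in> space M. real (card {i \<in> {..<n}. R (Z i \<omega>) \<le> r}) < (1 - \<alpha>) * real n}"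
      define E2 where "E2 = {\<omega> \<in> space M. infnorm (fit_without T n (S 0) (\<lambda>i. Z i \<omega>) - b) \<le>
        c k * sqrt (real k / (2 * \<kappa>\<^sub>1\<^sup>2) * l)}"
      have E1: "E1 \<in> sets F" and prob_E1: "prob (space M - E1) \<le> \<delta> / 2"
      proof -
        have card_eq: "real (card {i \<in> {..<n}. R (Z i \<omega>) \<le> r}) =
            (\<Sum>i<n. indicator {..r} (R (Z i \<omega>)))" for \<omega>
          by (simp add: indicator_def sum.If_cases Int_def flip: of_nat_sum)
        have "(\<lambda>\<omega>. \<Sum>i<n. indicator {..r} (R (Z i \<omega>)) :: real) \<in> borel_measurable F"
          by (intro borel_measurable_sum measurable_compose[OF measurable_compose[OF Z_F R(1)]]
              borel_measurable_indicator) auto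
        then show "E1 \<in> sets F"
          unfolding E1_def card_eq space_F[symmetric] by measurable
        have "indep_vars (\<lambda>_. N) Z {..<n}"
          using assms(12) unfolding N_def by (rule indep_vars_subset) auto
        then have "prob {\<omega> \<in> space M. real (card {i \<in> {..<n}. Z i \<omega> \<in> {z \<in> space N. R z \<le> r}}) \<ge>
            real n * ((1 - \<alpha> - s) + s)} \<le> exp (- 2 * real n * s\<^sup>2)"
        proof (rule indep_vars_count_le)
          show R_le: "{z \<in> space N. R z \<le> r} \<in> sets N"
            by measurable
          show "prob (Z i -` {z \<in> space N. R z \<le> r} \<inter> space M) = 1 - \<alpha> - s" if "i < n" for i
            using law[OF less_imp_le[OF that] R_le] r unfolding cdf by simp
        qed (use n s in auto)
        also have "{\<omega> \<in> space M. real (card {i \<in> {..<n}. Z i \<omega> \<in> {z \<in> space N. R z \<le> r}}) \<ge>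
            real n * ((1 - \<alpha> - s) + s)} = space M - E1"
        proof -
          have "{i \<in> {..<n}. Z i \<omega> \<in> {z \<in> space N. R z \<le> r}} = {i \<in> {..<n}. R (Z i \<omega>) \<le> r}"
            if "\<omega> \<in> space M" for \<omega>
            using measurable_space[OF Z that] by auto
          then show ?thesis
            by (auto simp: E1_def not_less mult.commute)
        qed
        also have "exp (- 2 * real n * s\<^sup>2) = \<delta> / 2"
          using n assms(20) True by (simp add: s(2) exp_minus)
        finally show "prob (space M - E1) \<le> \<delta> / 2" .
      qed
      have S0: "S i \<subseteq> {..<n}" "card (S i) = m" if "i < K" for i
        using assms(5) that by (auto simp: folds_def)
      have "0 < K"
        using assms(1) by simp
      \<comment> \<open>The increasing list of the \<open>k\<close> indices outside fold 0. It
        renumbers the remaining data as \<open>W\<close>, which has the law of a sample of size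
        \<open>k\<close>, the setting of the concentration bound.\<close>
      define js where "js = filter (\<lambda>j. j \<in> {..<n} - S 0) [0..<n]"
      have "length js = card ({..<n} - S 0)"
        unfolding js_def by (intro length_filter_upt) auto
      then have js: "length js = k" "distinct js" "set js \<subseteq> {..<n}"
        using S0[OF \<open>0 < K\<close>] finite_subset[of "S 0" "{..<n}"]
        by (auto simp: js_def card_Diff_subset k_def)
      define W where "W \<omega> = (\<lambda>j\<in>{..<k}. Z (js ! j) \<omega>)" for \<omega>
      have js_nth: "js ! j < n" if "j < k" for j
        using js that by (metis lessThan_iff nth_mem subsetD)
      have fit_W: "fit_without T n (S 0) (\<lambda>i. Z i \<omega>) = T (map (W \<omega>) [0..<k])" for \<omega>
      proof -
        have "map (W \<omega>) [0..<k] = map (\<lambda>i. Z i \<omega>) js"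
          using js(1) by (intro nth_equalityI) (auto simp: W_def)
        then show ?thesis
          by (simp add: fit_without_eq js_def)
      qed
      have T_meas: "(\<lambda>z. T (map z [0..<k])) \<in> borel_measurable (Pi\<^sub>M {..<k} (\<lambda>_. N))"
        using assms(10) k by (simp add: training_algorithm_def N_def)
      have inf_meas: "(\<lambda>z. infnorm (T (map z [0..<k]) - b)) \<in> borel_measurable (Pi\<^sub>M {..<k} (\<lambda>_. N))"
        by (rule measurable_compose[OF T_meas])
          (intro borel_measurable_continuous_onI continuous_intros)
      have E2: "E2 \<in> sets F" and prob_E2: "prob (space M - E2) \<le> \<epsilon>"
      proof -
        let ?t = "c k * sqrt (real k / (2 * \<kappa>\<^sub>1\<^sup>2) * l)"
        let ?Q = "Pi\<^sub>M {..<k} (\<lambda>_. N)"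
        have W_F: "W \<in> measurable F ?Q"
          unfolding W_def by (intro measurable_restrict Z_F js_nth) auto
        from measurable_compose[OF this inf_meas] show "E2 \<in> sets F"
          unfolding E2_def fit_W space_F[symmetric] by measurable
        have W: "W \<in> measurable M ?Q"
          using W_F sub by (rule measurable_from_subalg[rotated])
        have "distr M ?Q W = Pi\<^sub>M {..<k} (\<lambda>_. P)"
          unfolding W_def
        proof (rule distr_indep_vars_reindex)
          show "indep_vars (\<lambda>_. N) Z {..n}"
            using assms(12) by (simp add: N_def)
          show "inj_on ((!) js) {..<k}"
            using js by (auto simp: inj_on_def nth_eq_iff_index_eq)
        qed (use assms(13) js_nth in \<open>auto simp: N_def intro: less_imp_le\<close>)
        then have law_W: "measure (Pi\<^sub>M {..<k} (\<lambda>_. P)) D = prob (W -` D \<inter> space M)" if "D \<in> sets ?Q" for D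
          using measure_distr[OF W that] by simp
        have space_Q: "space (Pi\<^sub>M {..<k} (\<lambda>_. P)) = space ?Q"
          using sets_eq_imp_space_eq[OF P(2)] by (simp add: space_PiM)
        have "space M - E2 = W -` {z \<in> space ?Q. infnorm (T (map z [0..<k]) - b) > ?t} \<inter> space M"
          using measurable_space[OF W] by (auto simp: E2_def fit_W)
        also have "prob \<dots> = measure (Pi\<^sub>M {..<k} (\<lambda>_. P)) {z \<in> space ?Q. infnorm (T (map z [0..<k]) - b) > ?t}"
          using inf_meas by (intro law_W[symmetric]) measurable
        also have "\<dots> \<le> \<epsilon>"
          unfolding space_Q[symmetric] b_def l_def
          by (rule training_concentration[OF assms(9) MX assms(15,10) P(1) _ k ck assms(16,17,19) \<epsilon>])
            (use P in \<open>simp add: N_def\<close>)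
        finally show "prob (space M - E2) \<le> \<epsilon>" .
      qed
      \<comment> \<open>\<open>r\<close> and \<open>\<eta>\<close> are deterministic, so membership
        of the test point in \<open>B\<close> is independent of the training data.\<close>
      define B where "B = {z \<in> space N. r - 2 * \<eta> < R z}"
      have B: "B \<in> sets N"
        unfolding B_def by measurable
      have "prob (Z n -` B \<inter> space M) \<le> \<alpha> + s + 2 * L k * \<eta>"
      proof -
        interpret P: prob_space P by (rule P(1))
        have le_meas: "{z \<in> space N. R z \<le> r - 2 * \<eta>} \<in> P.events"
          unfolding P(2) by measurable
        have "B = space P - {z \<in> space N. R z \<le> r - 2 * \<eta>}"
          using sets_eq_imp_space_eq[OF P(2)] by (auto simp: B_def)
        then have "P.prob B = 1 - resid_cdf P \<mu> T k (r - 2 * \<eta>)"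
          using P.prob_compl[OF le_meas] by (simp add: cdf)
        \<comment> \<open>Lowering the threshold by \<open>2 * \<eta>\<close> adds at most
          \<open>2 * L k * \<eta>\<close> to the tail probability
          \<open>\<alpha> + s\<close>.\<close>
        moreover have "resid_cdf P \<mu> T k r - resid_cdf P \<mu> T k (r - 2 * \<eta>) \<le> L k * (r - (r - 2 * \<eta>))"
          using \<eta> by (intro has_density_increment_le[OF f]) simp
        ultimately show ?thesis
          using law[OF order_refl B] r by simp
      qed
      moreover have "AE \<omega> in M. \<omega> \<in> E1 \<inter> E2 \<longrightarrow>
          real_cond_exp M F (indicator A) \<omega> \<le> prob (Z n -` B \<inter> space M)"
      proof (rule real_cond_exp_indicator_le[OF sub])
        show "E1 \<inter> E2 \<in> sets F"
          using E1 E2 by simp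
        show "Z n -` B \<inter> space M \<in> events"
          using Z[OF order_refl] B by (rule measurable_sets)
        have "indep_vars (\<lambda>_. N) Z {..n}"
          using assms(12) by (simp add: N_def)
        then have indep: "indep_var (Pi\<^sub>M {..<n} (\<lambda>_. N)) (\<lambda>\<omega>. \<lambda>i\<in>{..<n}. Z i \<omega>)
            (Pi\<^sub>M {n} (\<lambda>_. N)) (\<lambda>\<omega>. \<lambda>i\<in>{n}. Z i \<omega>)"
          by (rule indep_var_restrict) auto
        \<comment> \<open>Independence is stated for restrictions to disjoint index sets, so the
          test point occurs as a function on \<open>{n}\<close> and \<open>B\<close> is pulled back
          along evaluation at \<open>n\<close>.\<close>
        let ?B = "(\<lambda>g. g n) -` B \<inter> space (Pi\<^sub>M {n} (\<lambda>_. N))"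
        have "?B \<in> sets (Pi\<^sub>M {n} (\<lambda>_. N))"
          by (rule measurable_sets[OF _ B]) simp
        moreover have "(\<lambda>\<omega>. \<lambda>i\<in>{n}. Z i \<omega>) -` ?B \<inter> space M = Z n -` B \<inter> space M"
          using sets.sets_into_space[OF B] by (auto simp: space_PiM)
        ultimately
        show "AE \<omega> in M. real_cond_exp M F (indicator (Z n -` B \<inter> space M)) \<omega> = prob (Z n -` B \<inter> space M)"
          using real_cond_exp_indep[OF indep, of ?B] by (simp add: F_def train_sigma_def)
        show "A \<inter> (E1 \<inter> E2) \<subseteq> Z n -` B \<inter> space M"
        proof
          fix \<omega> assume \<omega>: "\<omega> \<in> A \<inter> (E1 \<inter> E2)"
          then have \<omega>_space: "\<omega> \<in> space M"
            by (simp add: A_def)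
          let ?z = "\<lambda>i. Z i \<omega>"
          have z: "fst (?z i) \<in> space MX" if "i \<le> n" for i
            using Z_space[OF that \<omega>_space] by auto
          have "r - 2 * \<eta> < \<bar>snd (?z n) - \<mu> b (fst (?z n))\<bar>"
          proof (rule cv_plus_miscoverage_imp[OF assms(6,7), where n = n and K = K and S = S and z = ?z])
            fix i x assume i: "i < n" and x: "x \<in> space MX"
            let ?\<beta> = "fit_without T n (S (fold_index K S i)) ?z"
            let ?\<beta>\<^sub>0 = "fit_without T n (S 0) ?z"
            have fold: "fold_index K S i < K"
              using fold_index_eq[OF assms(5) i] by simp
            have "infnorm (?\<beta> - ?\<beta>\<^sub>0) \<le> real m * c k / \<kappa>\<^sub>1"
              unfolding k_def
              using S0[OF fold] S0[OF \<open>0 < K\<close>] assms(4) ck Z_space[OF less_imp_le \<omega>_space]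
              by (intro fit_without_infnorm_diff_le[OF assms(9) MX assms(15,16,17)]) (auto simp: k_def)
            moreover have "infnorm (?\<beta>\<^sub>0 - b) \<le> c k * sqrt (real k / (2 * \<kappa>\<^sub>1\<^sup>2) * l)"
              using \<omega> by (simp add: E2_def)
            \<comment> \<open>Enlarged by means of \<open>1 \<le> m\<close> and
              \<open>k \<le> n\<close>, so that both error terms share the factor
              \<open>m * c k\<close>.\<close>
            moreover have "c k * sqrt (real k / (2 * \<kappa>\<^sub>1\<^sup>2) * l) \<le>
                real m * c k * sqrt (real n / (2 * \<kappa>\<^sub>1\<^sup>2) * l)"
              using m n ck l assms(16)
              by (intro mult_mono) (auto intro!: mult_right_mono divide_right_mono)
            ultimately have "infnorm (?\<beta> - b) \<le>
                real m * c k / \<kappa>\<^sub>1 + real m * c k * sqrt (real n / (2 * \<kappa>\<^sub>1\<^sup>2) * l)"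
              using infnorm_triangle[of "?\<beta> - ?\<beta>\<^sub>0" "?\<beta>\<^sub>0 - b"] by simp
            then have "\<kappa>\<^sub>2 * infnorm (?\<beta> - b) \<le> \<eta>"
              using mult_left_mono[OF _ less_imp_le[OF \<kappa>\<^sub>2]] by (fastforce simp: \<eta>_def algebra_simps)
            moreover have "sup_norm MX (\<lambda>x. \<mu> ?\<beta> x - \<mu> b x) \<le> \<kappa>\<^sub>2 * infnorm (?\<beta> - b)"
              using assms(17) by (simp add: bi_lipschitz_def)
            moreover have "\<bar>\<mu> ?\<beta> x - \<mu> b x\<bar> \<le> sup_norm MX (\<lambda>x. \<mu> ?\<beta> x - \<mu> b x)"
              using assms(9) x
              by (intro abs_le_sup_norm bounded_minus_comp) (auto simp: predictor_model_def)
            ultimately show "\<bar>\<mu> ?\<beta> x - \<mu> b x\<bar> \<le> \<eta>"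
              by linarith
          qed (use \<omega> z in \<open>auto simp: A_def E1_def R_def\<close>)
          then show "\<omega> \<in> Z n -` B \<inter> space M"
            using \<omega>_space measurable_space[OF Z[OF order_refl] \<omega>_space] by (simp add: B_def R_def)
        qed
      qed (auto simp: A_def)
      \<comment> \<open>On the intersection of \<open>E1\<close> and \<open>E2\<close> the
        conditional miscoverage is almost surely at most the probability of \<open>B\<close>, hence
        within the threshold.\<close>
      ultimately have "AE \<omega> in M. \<omega> \<in> bad \<longrightarrow> \<omega> \<in> (space M - E1) \<union> (space M - E2)"
        unfolding bad_def by (auto elim!: eventually_mono)
      moreover have "E1 \<in> events" "E2 \<in> events"
        using E1 E2 sub by (auto simp: subalgebra_def)
      ultimately have "prob bad \<le> prob ((space M - E1) \<union> (space M - E2))"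
        by (intro finite_measure_mono_AE) auto
      also have "\<dots> \<le> prob (space M - E1) + prob (space M - E2)"
        using \<open>E1 \<in> events\<close> \<open>E2 \<in> events\<close> by (intro measure_Un_le) auto
      also have "\<dots> \<le> \<epsilon> + \<delta>"
        using prob_E1 prob_E2 assms(20) by simp
      finally show ?thesis .
    qed
  qed
  then show ?thesis
    unfolding bad_eq .
qed

end
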